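(* Let $\mathbb K$ be a field of characteristic zero, $n$ a positive integer and $r$ an integer with $2<r<n$. Let $E$ be the edge set of the complete graph $K_n$, $N=\#E$, and identify $E$ with $\{1,\ldots,N\}$. Let $M^r_{K_n}$ be the matroid on $E$ whose bases are the edge sets of the forests in $K_n$ with exactly $r$ edges, let $\Phi=\sum_{B}\prod_{b\in B}x_b$ (sum over bases $B$), and let $A=\mathbb K[x_1,\ldots,x_N]/\mathrm{Ann}(\Phi)=\bigoplus_{j=0}^r A_j$. Let $L=x_1+\cdots+x_N$. Then the multiplication map $\times L^{r-2}\colon A_1\to A_{r-1}$ is bijective.
   Context: $\mathrm{Ann}(\Phi)=\{P\in\mathbb K[x_1,\ldots,x_N]: P(\partial/\partial x_1,\ldots,\partial/\partial x_N)\Phi=0\}$, a homogeneous ideal; $A_j$ is the degree-$j$ homogeneous component of the graded quotient algebra $A$ (which is Artinian Gorenstein with $A_j=0$ for $j>r$). The matroid $M^r_{K_n}$ is the truncation to rank $r$ of the graphic matroid of $K_n$. *)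

theory Defs
  imports "HOL-Library.Poly_Mapping" "HOL-Algebra.QuotRing"
begin

section \<open>Multivariate polynomials\<close>

text \<open>A monomial is a finitely supported exponent function, and a polynomial is a finitely
  supported family of coefficients indexed by monomials. The type has all elements of
  \<^typ>\<open>'x\<close> as variables; \<open>poly_ring E\<close> below is the subring \<open>K[x\<^sub>e : e \<in> E]\<close>.\<close>

type_synonym 'x monom = "'x \<Rightarrow>\<^sub>0 nat"
type_synonym ('x, 'k) mpoly = "('x \<Rightarrow>\<^sub>0 nat) \<Rightarrow>\<^sub>0 'k"

definition var :: "'x \<Rightarrow> ('x, 'k::comm_ring_1) mpoly" where
  "var i = Poly_Mapping.single (Poly_Mapping.single i 1) 1"

definition const :: "'k \<Rightarrow> ('x, 'k::comm_ring_1) mpoly" where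
  "const c = Poly_Mapping.single 0 c"

definition monom_degree :: "'x monom \<Rightarrow> nat" where
  "monom_degree m = (\<Sum>i \<in> Poly_Mapping.keys m. Poly_Mapping.lookup m i)"

definition poly_ring :: "'x set \<Rightarrow> ('x, 'k::comm_ring_1) mpoly ring" where
  "poly_ring E = \<lparr>carrier = {p. \<forall>m \<in> Poly_Mapping.keys p. Poly_Mapping.keys m \<subseteq> E},
     mult = (*), one = 1, zero = 0, add = (+)\<rparr>"

definition homogeneous_polys :: "'x set \<Rightarrow> nat \<Rightarrow> ('x, 'k::comm_ring_1) mpoly set" where
  "homogeneous_polys E j =
     {p \<in> carrier (poly_ring E). \<forall>m \<in> Poly_Mapping.keys p. monom_degree m = j}"

section \<open>Polynomials acting as differential operators\<close>

text \<open>The truncated subtraction of exponents is harmless: when the exponent of \<open>i\<close> in \<open>m\<close> is \<open>0\<close>,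
  the coefficient vanishes.\<close>

definition partial_deriv :: "'x \<Rightarrow> ('x, 'k::comm_ring_1) mpoly \<Rightarrow> ('x, 'k) mpoly" where
  "partial_deriv i p = (\<Sum>m \<in> Poly_Mapping.keys p.
     Poly_Mapping.single (m - Poly_Mapping.single i 1)
       (of_nat (Poly_Mapping.lookup m i) * Poly_Mapping.lookup p m))"

text \<open>The composition over all variables of the \<open>m\<^sub>i\<close>-fold derivatives; the fold is independent of
  the order by \<open>partial_deriv_commute\<close>.\<close>

definition monom_deriv :: "'x monom \<Rightarrow> ('x, 'k::comm_ring_1) mpoly \<Rightarrow> ('x, 'k) mpoly" where
  "monom_deriv m p =
     Finite_Set.fold (\<lambda>i. partial_deriv i ^^ Poly_Mapping.lookup m i) p (Poly_Mapping.keys m)"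

definition diff_op :: "('x, 'k::comm_ring_1) mpoly \<Rightarrow> ('x, 'k) mpoly \<Rightarrow> ('x, 'k) mpoly" where
  "diff_op P p =
     (\<Sum>m \<in> Poly_Mapping.keys P. const (Poly_Mapping.lookup P m) * monom_deriv m p)"

definition Ann :: "'x set \<Rightarrow> ('x, 'k::comm_ring_1) mpoly \<Rightarrow> ('x, 'k) mpoly set" where
  "Ann E \<Phi> = {P \<in> carrier (poly_ring E). diff_op P \<Phi> = 0}"

definition ann_quot :: "'x set \<Rightarrow> ('x, 'k::comm_ring_1) mpoly \<Rightarrow> ('x, 'k) mpoly set ring" where
  "ann_quot E \<Phi> = poly_ring E Quot Ann E \<Phi>"

definition ann_class ::
  "'x set \<Rightarrow> ('x, 'k::comm_ring_1) mpoly \<Rightarrow> ('x, 'k) mpoly \<Rightarrow> ('x, 'k) mpoly set" where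
  "ann_class E \<Phi> p = Ann E \<Phi> +>\<^bsub>poly_ring E\<^esub> p"

definition ann_quot_component ::
  "'x set \<Rightarrow> ('x, 'k::comm_ring_1) mpoly \<Rightarrow> nat \<Rightarrow> ('x, 'k) mpoly set set" where
  "ann_quot_component E \<Phi> j = ann_class E \<Phi> ` homogeneous_polys E j"

section \<open>Forests in the complete graph\<close>

definition complete_edges :: "nat \<Rightarrow> nat set set" where
  "complete_edges n = {e. e \<subseteq> {1..n} \<and> card e = 2}"

definition is_cycle :: "'v set set \<Rightarrow> 'v list \<Rightarrow> bool" where
  "is_cycle F vs \<longleftrightarrow> 3 \<le> length vs \<and> distinct vs \<and>
     (\<forall>i < length vs. {vs ! i, vs ! (Suc i mod length vs)} \<in> F)"

definition is_forest :: "'v set set \<Rightarrow> bool" where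
  "is_forest F \<longleftrightarrow> (\<nexists>vs. is_cycle F vs)"

definition truncated_graphic_bases :: "nat \<Rightarrow> nat \<Rightarrow> nat set set set" where
  "truncated_graphic_bases n r = {B. B \<subseteq> complete_edges n \<and> is_forest B \<and> card B = r}"

definition bases_poly :: "'x set set \<Rightarrow> ('x, 'k::comm_ring_1) mpoly" where
  "bases_poly \<B> = (\<Sum>B \<in> \<B>. \<Prod>b \<in> B. var b)"

section \<open>Well-definedness of the quotient ring\<close>

lemma lookup_partial_deriv:
  "Poly_Mapping.lookup (partial_deriv i p) u =
     of_nat (Poly_Mapping.lookup u i + 1) * Poly_Mapping.lookup p (u + Poly_Mapping.single i 1)"
proof -
  have eq: "(of_nat (Poly_Mapping.lookup m i) * Poly_Mapping.lookup p m
               when m - Poly_Mapping.single i 1 = u)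
      = (of_nat (Poly_Mapping.lookup m i) * Poly_Mapping.lookup p m
               when m = u + Poly_Mapping.single i 1)" for m
  proof (cases "Poly_Mapping.lookup m i = 0")
    case True
    then show ?thesis by (simp add: when_def)
  next
    case False
    have "m - Poly_Mapping.single i 1 = u \<longleftrightarrow> m = u + Poly_Mapping.single i 1"
    proof
      assume u: "m - Poly_Mapping.single i 1 = u"
      show "m = u + Poly_Mapping.single i 1"
        unfolding u[symmetric]
        by (rule poly_mapping_eqI)
          (use False in \<open>auto simp: lookup_add lookup_minus lookup_single when_def\<close>)
    qed simp
    then show ?thesis by simp
  qed
  have "Poly_Mapping.lookup (partial_deriv i p) u = (\<Sum>m \<in> Poly_Mapping.keys p.
      (of_nat (Poly_Mapping.lookup m i) * Poly_Mapping.lookup p m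
        when m = u + Poly_Mapping.single i 1))"
    by (simp add: partial_deriv_def lookup_sum lookup_single eq del: One_nat_def)
  also have "\<dots> = of_nat (Poly_Mapping.lookup u i + 1)
      * Poly_Mapping.lookup p (u + Poly_Mapping.single i 1)"
    by (auto simp: when_def sum.delta' lookup_add not_in_keys_iff_lookup_eq_zero)
  finally show ?thesis .
qed

lemma partial_deriv_commute:
  "partial_deriv i (partial_deriv j p) = partial_deriv j (partial_deriv i p)"
  by (rule poly_mapping_eqI)
    (cases "i = j", auto simp: lookup_partial_deriv lookup_add lookup_single ac_simps)

lemma partial_deriv_add: "partial_deriv i (p + q) = partial_deriv i p + partial_deriv i q"
  by (rule poly_mapping_eqI) (simp add: lookup_partial_deriv lookup_add algebra_simps)

lemma partial_deriv_0 [simp]: "partial_deriv i 0 = 0"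
  by (simp add: partial_deriv_def)

lemma lookup_const_mult: "Poly_Mapping.lookup (const c * p) u = c * Poly_Mapping.lookup p u"
proof -
  have "Poly_Mapping.lookup (const c * p) u
      = Poly_Mapping.lookup (Poly_Mapping.map ((*) c) p) u"
    unfolding const_def by (simp add: mult_map_scale_conv_mult)
  then show ?thesis by (simp add: Poly_Mapping.map.rep_eq when_def)
qed

lemma partial_deriv_const_mult: "partial_deriv i (const c * p) = const c * partial_deriv i p"
  by (rule poly_mapping_eqI) (simp add: lookup_partial_deriv lookup_const_mult mult.left_commute)

lemma partial_deriv_funpow_commute:
  "(partial_deriv i ^^ a) ((partial_deriv j ^^ b) p) = (partial_deriv j ^^ b) ((partial_deriv i ^^ a) p)"
proof -
  have 1: "partial_deriv i ((partial_deriv j ^^ b) p) = (partial_deriv j ^^ b) (partial_deriv i p)"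
    for p
    by (induction b) (auto simp: partial_deriv_commute[of i j])
  show ?thesis by (induction a) (auto simp: 1)
qed

lemma comp_fun_commute_partial_deriv:
  "comp_fun_commute (\<lambda>i. partial_deriv i ^^ f i)"
  by unfold_locales (auto simp: fun_eq_iff partial_deriv_funpow_commute)

lemma monom_deriv_superset:
  assumes "finite S" "Poly_Mapping.keys m \<subseteq> S"
  shows "monom_deriv m p = Finite_Set.fold (\<lambda>i. partial_deriv i ^^ Poly_Mapping.lookup m i) p S"
proof -
  interpret comp_fun_commute "\<lambda>i. partial_deriv i ^^ Poly_Mapping.lookup m i"
    by (rule comp_fun_commute_partial_deriv)
  have "Finite_Set.fold (\<lambda>i. partial_deriv i ^^ Poly_Mapping.lookup m i) p (Poly_Mapping.keys m \<union> T)
      = monom_deriv m p" if "finite T" "T \<inter> Poly_Mapping.keys m = {}" for T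
    using that
  proof (induction T)
    case empty
    then show ?case by (simp add: monom_deriv_def)
  next
    case (insert x T)
    then have "Poly_Mapping.lookup m x = 0" by (simp add: not_in_keys_iff_lookup_eq_zero)
    with insert show ?case by simp
  qed
  from this[of "S - Poly_Mapping.keys m"] assms show ?thesis
    by (simp add: Un_absorb1 Diff_disjoint Int_commute)
qed

lemma fold_partial_deriv_commute:
  assumes "finite S"
  shows "(partial_deriv j ^^ b) (Finite_Set.fold (\<lambda>i. partial_deriv i ^^ f i) p S)
    = Finite_Set.fold (\<lambda>i. partial_deriv i ^^ f i) ((partial_deriv j ^^ b) p) S"
proof -
  interpret comp_fun_commute "\<lambda>i. partial_deriv i ^^ f i"
    by (rule comp_fun_commute_partial_deriv)
  show ?thesis using assms
    by (induction S) (auto simp: partial_deriv_funpow_commute[of _ j])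
qed

lemma monom_deriv_plus: "monom_deriv (m + m') p = monom_deriv m (monom_deriv m' p)"
proof -
  let ?S = "Poly_Mapping.keys m \<union> Poly_Mapping.keys m'"
  let ?fold = "\<lambda>f p S. Finite_Set.fold (\<lambda>i. partial_deriv i ^^ f i) p S"
  have "?fold (\<lambda>i. f i + g i) p S = ?fold f (?fold g p S) S" if "finite S" for f g :: "_ \<Rightarrow> nat" and S
  proof -
    interpret f: comp_fun_commute "\<lambda>i. partial_deriv i ^^ f i"
      by (rule comp_fun_commute_partial_deriv)
    interpret g: comp_fun_commute "\<lambda>i. partial_deriv i ^^ g i"
      by (rule comp_fun_commute_partial_deriv)
    interpret fg: comp_fun_commute "\<lambda>i. partial_deriv i ^^ (f i + g i)"
      by (rule comp_fun_commute_partial_deriv)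
    show ?thesis using that
    proof (induction S)
      case (insert x S)
      have "?fold (\<lambda>i. f i + g i) p (insert x S)
          = (partial_deriv x ^^ (f x + g x)) (?fold f (?fold g p S) S)"
        using insert by simp
      also have "\<dots> = ?fold f (?fold g p (insert x S)) (insert x S)"
        using insert by (simp add: funpow_add fold_partial_deriv_commute)
      finally show ?case .
    qed simp
  qed
  from this[of ?S "Poly_Mapping.lookup m" "Poly_Mapping.lookup m'"] show ?thesis
    using Poly_Mapping.keys_add[of m m']
    by (simp add: monom_deriv_superset[of ?S] lookup_add)
qed

lemma funpow_partial_deriv_linear:
  "(partial_deriv i ^^ a) (p + q) = (partial_deriv i ^^ a) p + (partial_deriv i ^^ a) q"
  "(partial_deriv i ^^ a) (const c * p) = const c * (partial_deriv i ^^ a) p"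
  "(partial_deriv i ^^ a) 0 = 0"
  by (induction a) (auto simp: partial_deriv_add partial_deriv_const_mult)

lemma monom_deriv_linear:
  fixes p q :: "('x, 'k::comm_ring_1) mpoly"
  shows "monom_deriv m (p + q) = monom_deriv m p + monom_deriv m q"
  "monom_deriv m (const c * p) = const c * monom_deriv m p"
  "monom_deriv m (0 :: ('x, 'k) mpoly) = 0"
proof -
  interpret comp_fun_commute "\<lambda>i. partial_deriv i ^^ Poly_Mapping.lookup m i"
    by (rule comp_fun_commute_partial_deriv)
  let ?fold = "Finite_Set.fold (\<lambda>i. (partial_deriv i :: ('x, 'k) mpoly \<Rightarrow> _) ^^ Poly_Mapping.lookup m i)"
  have "?fold (p + q) S = ?fold p S + ?fold q S" "?fold (const c * p) S = const c * ?fold p S"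
    "?fold (0 :: ('x, 'k) mpoly) S = 0" if "finite S" for S
    using that by (induction S) (auto simp: funpow_partial_deriv_linear)
  then show "monom_deriv m (p + q) = monom_deriv m p + monom_deriv m q"
    "monom_deriv m (const c * p) = const c * monom_deriv m p" "monom_deriv m (0 :: ('x, 'k) mpoly) = 0"
    by (simp_all add: monom_deriv_def)
qed

lemma const_simps: "const 0 = 0" "const (a + b) = const a + const b" "const (a * b) = const a * const b"
  by (simp_all add: const_def single_add mult_single)

lemma diff_op_add: "diff_op (P + Q) p = diff_op P p + diff_op Q p"
  unfolding diff_op_def
  by (rule setsum_keys_plus_distrib) (simp_all add: const_simps distrib_right)

lemma diff_op_0 [simp]: "diff_op 0 p = 0"
  by (simp add: diff_op_def)

lemma diff_op_single: "diff_op (Poly_Mapping.single m c) p = const c * monom_deriv m p"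
  by (cases "c = 0") (simp_all add: diff_op_def const_simps)

lemma diff_op_sum: "diff_op (sum f S) p = (\<Sum>x\<in>S. diff_op (f x) p)"
  by (induction S rule: infinite_finite_induct) (simp_all add: diff_op_add)

lemma diff_op_arg_linear:
  "diff_op P (p + q) = diff_op P p + diff_op P q" "diff_op P (const c * p) = const c * diff_op P p"
  "diff_op P 0 = 0"
  by (simp_all add: diff_op_def monom_deriv_linear sum.distrib sum_distrib_left distrib_left
      mult.left_commute)

lemma monom_deriv_sum: "monom_deriv m (sum f S) = (\<Sum>x\<in>S. monom_deriv m (f x))"
  by (induction S rule: infinite_finite_induct) (simp_all add: monom_deriv_linear)

lemma mpoly_eq_sum_single:
  "p = (\<Sum>m \<in> Poly_Mapping.keys p. Poly_Mapping.single m (Poly_Mapping.lookup p m))"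
  by (rule poly_mapping_eqI)
    (auto simp: lookup_sum lookup_single when_def sum.delta' not_in_keys_iff_lookup_eq_zero)

lemma diff_op_mult: "diff_op (P * Q) p = diff_op P (diff_op Q p)"
proof -
  let ?s = "\<lambda>P m. Poly_Mapping.single m (Poly_Mapping.lookup P m)"
  have "diff_op (P * Q) p = diff_op ((\<Sum>m\<in>Poly_Mapping.keys P. ?s P m) * (\<Sum>m\<in>Poly_Mapping.keys Q. ?s Q m)) p"
    using mpoly_eq_sum_single[of P] mpoly_eq_sum_single[of Q] by simp
  also have "\<dots> = (\<Sum>m\<in>Poly_Mapping.keys P. \<Sum>m'\<in>Poly_Mapping.keys Q.
      const (Poly_Mapping.lookup P m) * (const (Poly_Mapping.lookup Q m')
        * monom_deriv m (monom_deriv m' p)))"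
    by (simp add: sum_product diff_op_sum mult_single diff_op_single const_simps monom_deriv_plus
        mult.assoc)
  also have "\<dots> = diff_op P (diff_op Q p)"
    by (simp add: diff_op_def monom_deriv_sum monom_deriv_linear sum_distrib_left)
  finally show ?thesis .
qed

lemma poly_ring_simps [simp]:
  "mult (poly_ring E) = (*)" "one (poly_ring E) = 1" "zero (poly_ring E) = 0"
  "add (poly_ring E) = (+)"
  by (simp_all add: poly_ring_def)

lemma poly_ring_carrier:
  "p \<in> carrier (poly_ring E) \<longleftrightarrow> (\<forall>m \<in> Poly_Mapping.keys p. Poly_Mapping.keys m \<subseteq> E)"
  by (simp add: poly_ring_def)

lemma poly_ring_closed:
  assumes "p \<in> carrier (poly_ring E)" "q \<in> carrier (poly_ring E)"
  shows "p + q \<in> carrier (poly_ring E)" "p * q \<in> carrier (poly_ring E)"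
    "- p \<in> carrier (poly_ring E)"
proof -
  show "p + q \<in> carrier (poly_ring E)"
    using assms Poly_Mapping.keys_add[of p q] by (auto simp: poly_ring_carrier)
  show "- p \<in> carrier (poly_ring E)"
    using assms by (simp add: poly_ring_carrier)
  show "p * q \<in> carrier (poly_ring E)"
    unfolding poly_ring_carrier
  proof
    fix m assume "m \<in> Poly_Mapping.keys (p * q)"
    then obtain a b where "a \<in> Poly_Mapping.keys p" "b \<in> Poly_Mapping.keys q" "m = a + b"
      using keys_mult[of p q] by blast
    then show "Poly_Mapping.keys m \<subseteq> E"
      using assms Poly_Mapping.keys_add[of a b] unfolding poly_ring_carrier by blast
  qed
qed

lemma poly_ring_cring: "cring (poly_ring E)"
proof (rule cringI)
  show "abelian_group (poly_ring E)"
  proof (rule abelian_groupI)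
    show "\<exists>q\<in>carrier (poly_ring E). q \<oplus>\<^bsub>poly_ring E\<^esub> p = \<zero>\<^bsub>poly_ring E\<^esub>"
      if "p \<in> carrier (poly_ring E)" for p
      by (rule bexI[of _ "- p"]) (use that poly_ring_closed in auto)
  qed (auto simp: poly_ring_closed add.assoc add.commute, simp add: poly_ring_carrier)
  show "Group.comm_monoid (poly_ring E)"
    by unfold_locales (auto simp: poly_ring_closed mult.assoc mult.commute, simp add: poly_ring_carrier)
qed (simp add: distrib_right)

lemma poly_ring_a_inv:
  assumes "p \<in> carrier (poly_ring E)"
  shows "\<ominus>\<^bsub>poly_ring E\<^esub> p = - p"
proof -
  interpret cring "poly_ring E" by (rule poly_ring_cring)
  show ?thesis
    using minus_equality[of "- p" p] assms poly_ring_closed[OF assms assms] by simp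
qed

lemma Ann_ideal: "ideal (Ann E \<Phi>) (poly_ring E)"
proof (rule idealI)
  interpret cring "poly_ring E" by (rule poly_ring_cring)
  show "ring (poly_ring E)" by (rule ring_axioms)
  show "subgroup (Ann E \<Phi>) (add_monoid (poly_ring E))"
  proof (rule add.subgroupI)
    show "Ann E \<Phi> \<noteq> {}" by (auto simp: Ann_def poly_ring_carrier intro!: exI[of _ 0])
    show "\<ominus>\<^bsub>poly_ring E\<^esub> a \<in> Ann E \<Phi>" if "a \<in> Ann E \<Phi>" for a
    proof -
      have "diff_op (- a) \<Phi> = 0"
        using diff_op_add[of "- a" a \<Phi>] that by (simp add: Ann_def)
      with that show ?thesis
        by (auto simp: Ann_def poly_ring_a_inv poly_ring_closed)
    qed
  qed (auto simp: Ann_def poly_ring_closed diff_op_add)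
  show "x \<otimes>\<^bsub>poly_ring E\<^esub> a \<in> Ann E \<Phi>" if "a \<in> Ann E \<Phi>" "x \<in> carrier (poly_ring E)" for a x
    using that by (auto simp: Ann_def poly_ring_closed diff_op_mult diff_op_arg_linear)
  then show "a \<otimes>\<^bsub>poly_ring E\<^esub> x \<in> Ann E \<Phi>" if "a \<in> Ann E \<Phi>" "x \<in> carrier (poly_ring E)" for a x
    using that by (simp add: mult.commute)
qed

end

theory Submission
  imports Defs Complex_Main "HOL-Combinatorics.Transposition"
begin

text \<open>Up to the factor \<open>(r - 2)!\<close>, the map \<open>\<times>L\<^bsup>r-2\<^esup>\<close> from linear forms to the linear forms
  \<open>Q(\<partial>)\<Phi>\<close>, \<open>deg Q = r - 1\<close>, has the matrix whose \<open>(e, f)\<close> entry is the number of \<open>r\<close>-edge forests through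
  \<open>e \<noteq> f\<close>, with zeros on the diagonal. By symmetry this number is \<open>a\<close> for adjacent and \<open>b\<close> for
  disjoint edges, so the eigenvalues are \<open>b - 2a\<close>, \<open>(n - 4)a - (n - 3)b\<close> and a positive number.

  Count \<open>r\<close>-forests as \<open>(r - 1)\<close>-forests \<open>G\<close> together with an edge joining two components.
  If \<open>G\<close> contains \<open>12\<close> and separates \<open>3\<close> from \<open>4\<close>, then it separates \<open>1\<close> from \<open>3\<close> or from \<open>4\<close>; hence
  \<open>b \<le> 2a\<close>, strictly because some \<open>G\<close> contains both \<open>12\<close> and \<open>34\<close> in different components.
  For the other eigenvalue, \<open>(n - 3)b - (n - 4)a\<close> is a positive multiple of the sum over all \<open>G\<close> of
  \<open>(\<Sum>\<^sub>q c(q)) (\<Sum>\<^sub>q 1/c(q)) - n\<^sup>2\<close>, where \<open>c(q)\<close> is the size of the component of the vertex \<open>q\<close>.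
  This is nonnegative by Cauchy-Schwarz, and positive when \<open>G\<close> is a star.\<close>

section \<open>Connectivity and forests\<close>

text \<open>No vertex set enters: a vertex on no edge is connected to itself only, so isolated
  vertices form components of their own.\<close>

definition conn :: "'v set set \<Rightarrow> 'v \<Rightarrow> 'v \<Rightarrow> bool" where
  "conn F = (\<lambda>x y. {x, y} \<in> F)\<^sup>*\<^sup>*"

lemma conn_refl [simp]: "conn F x x"
  by (simp add: conn_def)

lemma conn_edge: "{x, y} \<in> F \<Longrightarrow> conn F x y"
  by (auto simp: conn_def)

lemma conn_trans: "conn F x y \<Longrightarrow> conn F y z \<Longrightarrow> conn F x z"
  by (auto simp: conn_def)

lemma conn_sym: "conn F x y \<Longrightarrow> conn F y x"
  unfolding conn_def
  by (rule sympD[OF symp_rtranclp]) (auto simp: symp_def insert_commute)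

lemma conn_mono: "conn F x y \<Longrightarrow> F \<subseteq> F' \<Longrightarrow> conn F' x y"
  unfolding conn_def by (erule rtranclp_mono[THEN predicate2D, rotated]) auto

text \<open>The tool for proving that two vertices are not connected: exhibit a set, closed under
  taking neighbours, that contains one of them but not the other.\<close>

lemma conn_closed:
  assumes "conn F x y" "x \<in> A" "\<And>u v. u \<in> A \<Longrightarrow> {u, v} \<in> F \<Longrightarrow> v \<in> A"
  shows "y \<in> A"
  using assms(1) unfolding conn_def by (induction rule: rtranclp_induct) (use assms in auto)

text \<open>One crossing of the new edge suffices: a walk that crosses it a second time is back in a
  component of \<open>F\<close> it has already visited.\<close>

lemma conn_insert:
  "conn (insert {u, v} F) x y \<longleftrightarrow>
     conn F x y \<or> conn F x u \<and> conn F v y \<or> conn F x v \<and> conn F u y" (is "?L \<longleftrightarrow> ?R")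
proof
  assume ?L
  then show ?R unfolding conn_def[of "insert {u, v} F"]
  proof (induction rule: rtranclp_induct)
    case (step y z)
    from step.hyps(2) consider "{y, z} \<in> F" | "y = u" "z = v" | "y = v" "z = u"
      by (auto simp: doubleton_eq_iff)
    then show ?case
    proof cases
      case 1
      then have "conn F y z" by (rule conn_edge)
      with step.IH show ?thesis using conn_trans by metis
    next
      case 2
      with step.IH show ?thesis using conn_trans conn_sym conn_refl by metis
    next
      case 3
      with step.IH show ?thesis using conn_trans conn_sym conn_refl by metis
    qed
  qed simp
next
  have uv: "conn (insert {u, v} F) u v" by (rule conn_edge) simp
  have mono: "conn F x y \<Longrightarrow> conn (insert {u, v} F) x y" for x y
    by (rule conn_mono) auto
  assume ?R
  then show ?L using uv mono conn_trans conn_sym by metis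
qed

text \<open>The path grows along the walk; when the walk returns to a vertex already on the path,
  the path is cut back to that vertex.\<close>

lemma conn_imp_distinct_path:
  assumes "conn F x y"
  shows "\<exists>p. p \<noteq> [] \<and> hd p = x \<and> last p = y \<and> distinct p
    \<and> (\<forall>i. Suc i < length p \<longrightarrow> {p ! i, p ! Suc i} \<in> F)"
  using assms unfolding conn_def
proof (induction rule: rtranclp_induct)
  case base
  show ?case by (rule exI[of _ "[x]"]) simp
next
  case (step y z)
  then obtain p where p: "p \<noteq> []" "hd p = x" "last p = y" "distinct p"
    "\<And>i. Suc i < length p \<Longrightarrow> {p ! i, p ! Suc i} \<in> F" by blast
  show ?case
  proof (cases "z \<in> set p")
    case True
    then obtain k where k: "k < length p" "p ! k = z" by (auto simp: in_set_conv_nth)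
    have "last (take (Suc k) p) = z" using k by (simp add: take_Suc_conv_app_nth)
    then show ?thesis
      using k p by (intro exI[of _ "take (Suc k) p"]) (auto simp: hd_take)
  next
    case False
    have "{(p @ [z]) ! i, (p @ [z]) ! Suc i} \<in> F" if "Suc i < length (p @ [z])" for i
    proof (cases "Suc i < length p")
      case False
      with that have "i = length p - 1" using p(1) by (cases p) auto
      then show ?thesis using p(1,3) step.hyps(2) by (auto simp: nth_append last_conv_nth)
    qed (use p(5) in \<open>auto simp: nth_append\<close>)
    then show ?thesis using p False by (intro exI[of _ "p @ [z]"]) auto
  qed
qed

lemma is_forest_mono: "is_forest F \<Longrightarrow> F' \<subseteq> F \<Longrightarrow> is_forest F'"
  unfolding is_forest_def is_cycle_def by blast

text \<open>A cycle is a simple path together with an edge joining its ends. This trades cyclic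
  vertex lists for connectivity, the form in which forests are handled from here on.\<close>

lemma is_forest_iff_bridges:
  "is_forest F \<longleftrightarrow> (\<forall>u v. u \<noteq> v \<longrightarrow> {u, v} \<in> F \<longrightarrow> \<not> conn (F - {{u, v}}) u v)" (is "?L \<longleftrightarrow> ?R")
proof
  assume forest: ?L
  show ?R
  proof (intro allI impI notI)
    fix u v assume uv: "u \<noteq> v" "{u, v} \<in> F" and "conn (F - {{u, v}}) u v"
    from conn_imp_distinct_path[OF this(3)] obtain p where p: "p \<noteq> []" "hd p = u" "last p = v"
      "distinct p" "\<And>i. Suc i < length p \<Longrightarrow> {p ! i, p ! Suc i} \<in> F - {{u, v}}" by blast
    have hl: "p ! 0 = u" "p ! (length p - 1) = v" using p by (auto simp: hd_conv_nth last_conv_nth)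
    have "length p \<noteq> 1" using hl uv by auto
    \<comment> \<open>A path with just two vertices would be the deleted edge itself.\<close>
    moreover have "length p \<noteq> 2"
    proof
      assume "length p = 2"
      with p(5)[of 0] hl show False by (simp add: numeral_2_eq_2)
    qed
    ultimately have len: "3 \<le> length p" using p(1) by (cases "length p") auto
    have "{p ! i, p ! (Suc i mod length p)} \<in> F" if "i < length p" for i
    proof (cases "Suc i < length p")
      case True
      with p(5) show ?thesis by auto
    next
      case False
      with that have i: "Suc i = length p" by simp
      then have "i = length p - 1" by simp
      with i hl uv show ?thesis by (simp add: insert_commute)
    qed
    with len p(4) have "is_cycle F p" by (simp add: is_cycle_def)
    with forest show False by (simp add: is_forest_def)
  qed
next
  assume R: ?R
  show ?L unfolding is_forest_def
  proof
    assume "\<exists>vs. is_cycle F vs"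
    then obtain vs where len: "3 \<le> length vs" and dist: "distinct vs"
      and edge: "\<And>i. i < length vs \<Longrightarrow> {vs ! i, vs ! (Suc i mod length vs)} \<in> F"
      unfolding is_cycle_def by blast
    let ?l = "length vs - 1"
    let ?e = "{vs ! 0, vs ! ?l}"
    have "conn (F - {?e}) (vs ! 0) (vs ! i)" if "i < length vs" for i
      using that
    proof (induction i)
      case (Suc i)
      have "{vs ! i, vs ! Suc i} \<in> F" using edge[of i] Suc.prems by simp
      \<comment> \<open>Consecutive positions coincide with the first and last one only in a list of
        length two.\<close>
      moreover have "{vs ! i, vs ! Suc i} \<noteq> ?e"
      proof -
        have "vs \<noteq> []" using len by auto
        then show ?thesis using dist len Suc.prems
          by (auto simp: doubleton_eq_iff nth_eq_iff_index_eq)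
      qed
      ultimately show ?case using Suc by (intro conn_trans[OF Suc.IH conn_edge]) auto
    qed simp
    from this[of ?l] have "conn (F - {?e}) (vs ! 0) (vs ! ?l)" using len by simp
    moreover have "vs ! 0 \<noteq> vs ! ?l"
      using len nth_eq_iff_index_eq[OF dist, of 0 ?l] by (cases vs) auto
    moreover have "?e \<in> F"
      using edge[of ?l] len by (cases vs) (auto simp: insert_commute)
    ultimately show False using R by blast
  qed
qed

text \<open>The recursion behind every count and induction below: an edge may be added to a forest
  exactly when it joins two components.\<close>

lemma is_forest_insert_iff:
  assumes "u \<noteq> v" "{u, v} \<notin> G"
  shows "is_forest (insert {u, v} G) \<longleftrightarrow> is_forest G \<and> \<not> conn G u v"
proof (intro iffI conjI)
  assume forest: "is_forest (insert {u, v} G)"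
  then show "is_forest G" by (rule is_forest_mono) auto
  from forest assms show "\<not> conn G u v"
    unfolding is_forest_iff_bridges by (metis Diff_insert_absorb insertI1)
next
  assume G: "is_forest G \<and> \<not> conn G u v"
  show "is_forest (insert {u, v} G)" unfolding is_forest_iff_bridges
  proof (intro allI impI notI)
    fix x y assume xy: "x \<noteq> y" "{x, y} \<in> insert {u, v} G"
      and conn: "conn (insert {u, v} G - {{x, y}}) x y"
    show False
    proof (cases "{x, y} = {u, v}")
      case True
      then have "conn G x y" using conn assms by simp
      with True G show False using conn_sym[of G x y] by (auto simp: doubleton_eq_iff)
    next
      case False
      \<comment> \<open>As \<open>{x, y}\<close> is a bridge of \<open>G\<close>, a connection of
        \<open>x\<close> and \<open>y\<close> avoiding it must cross the new edge. Since
        \<open>x\<close> and \<open>y\<close> are connected in \<open>G\<close>, this would connect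
        \<open>u\<close> with \<open>v\<close> in \<open>G\<close>.\<close>
      define H where "H = G - {{x, y}}"
      have "insert {u, v} G - {{x, y}} = insert {u, v} H" using False by (auto simp: H_def)
      with conn have "conn H x y \<or> conn H x u \<and> conn H v y \<or> conn H x v \<and> conn H u y"
        by (simp add: conn_insert)
      moreover have "\<not> conn H x y"
        using G xy False unfolding H_def is_forest_iff_bridges by blast
      moreover have "conn G x y" using xy False by (auto intro: conn_edge)
      moreover have "conn H p q \<Longrightarrow> conn G p q" for p q
        by (rule conn_mono) (auto simp: H_def)
      ultimately show False using G conn_sym conn_trans by metis
    qed
  qed
qed

lemma is_forest_insert_leaf:
  assumes "is_forest G" "u \<noteq> v" "v \<notin> \<Union>G"
  shows "is_forest (insert {u, v} G)"
proof -
  have "\<not> conn G v u"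
    using conn_closed[of G v u "{v}"] assms by auto
  then show ?thesis using assms conn_sym[of G u v] by (subst is_forest_insert_iff) auto
qed

lemma is_forest_star:
  assumes "finite I" "c \<notin> I"
  shows "is_forest ((\<lambda>i. {c, i}) ` I)"
  using assms
proof (induction I)
  case empty
  show ?case by (auto simp: is_forest_def is_cycle_def intro!: exI[of _ 0])
next
  case (insert i I)
  then show ?case by (auto intro!: is_forest_insert_leaf)
qed

section \<open>Component sizes and degree sums in a forest\<close>

definition comp_size :: "'v set \<Rightarrow> 'v set set \<Rightarrow> 'v \<Rightarrow> real" where
  "comp_size V F q = real (card {w \<in> V. conn F q w})"

text \<open>For loopless \<open>F\<close> this is the vertex degree, written as a sum of indicators
  so that it can be interchanged with other vertex sums.\<close>

definition deg :: "'v set \<Rightarrow> 'v set set \<Rightarrow> 'v \<Rightarrow> real" where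
  "deg V F q = (\<Sum>p\<in>V. of_bool ({p, q} \<in> F))"

lemma comp_size_pos: "finite V \<Longrightarrow> q \<in> V \<Longrightarrow> 0 < comp_size V F q"
  by (auto simp: comp_size_def card_gt_0_iff)

lemma comp_size_cong: "conn F p q \<Longrightarrow> comp_size V F p = comp_size V F q"
proof -
  assume "conn F p q"
  then have "conn F p w \<longleftrightarrow> conn F q w" for w
    using conn_sym conn_trans by metis
  then show ?thesis by (simp add: comp_size_def)
qed

text \<open>All vertices of a component carry the same size, so each component contributes one; over
  all of \<open>V\<close> the reciprocals therefore count the components.\<close>

lemma sum_inverse_comp_size:
  assumes "finite V" "u \<in> V"
  shows "(\<Sum>q\<in>{w \<in> V. conn F u w}. 1 / comp_size V F q) = 1"
proof -
  have "(\<Sum>q\<in>{w \<in> V. conn F u w}. 1 / comp_size V F q)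
      = (\<Sum>q\<in>{w \<in> V. conn F u w}. 1 / comp_size V F u)"
    by (rule sum.cong) (auto dest!: comp_size_cong[of F u _ V])
  also have "\<dots> = 1"
    using comp_size_pos[OF assms, of F] by (simp add: comp_size_def)
  finally show ?thesis .
qed

text \<open>The amount that one new edge adds to a degree-weighted sum: the ordered pairs see it in
  both directions, once for each end.\<close>

lemma sum_doubleton_edge:
  fixes h :: "'v \<Rightarrow> real"
  assumes "finite V" "u \<in> V" "v \<in> V" "u \<noteq> v"
  shows "(\<Sum>q\<in>V. \<Sum>p\<in>V. of_bool ({p, q} = {u, v}) * h q) = h u + h v"
proof -
  have "(\<Sum>p\<in>V. of_bool ({p, q} = {u, v}) * h q)
      = (if q = u then h u else 0) + (if q = v then h v else 0)" for q
  proof -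
    have "(\<Sum>p\<in>V. of_bool ({p, q} = {u, v}) * h q)
        = (\<Sum>p\<in>V. (if p = v then of_bool (q = u) * h q else 0) + (if p = u then of_bool (q = v) * h q else 0))"
      using assms(4) by (intro sum.cong) (auto simp: doubleton_eq_iff)
    then show ?thesis using assms by (auto simp: sum.distrib sum.delta)
  qed
  then show ?thesis using assms by (simp add: sum.distrib sum.delta)
qed

text \<open>A component with \<open>c\<close> vertices of a forest has \<open>c - 1\<close> edges; as a vertex sum, this spreads
  \<open>c - 1\<close> evenly over the component.\<close>

lemma sum_deg_forest:
  fixes h :: "'v \<Rightarrow> real"
  assumes "finite V" "finite F" "is_forest F" "\<And>e. e \<in> F \<Longrightarrow> e \<subseteq> V \<and> card e = 2"
    and "\<And>x y. conn F x y \<Longrightarrow> h x = h y"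
  shows "(\<Sum>q\<in>V. deg V F q * h q) = 2 * (\<Sum>q\<in>V. h q * (1 - 1 / comp_size V F q))"
  using assms(2-)
proof (induction F)
  case empty
  have "conn {} x y \<longleftrightarrow> x = y" for x y :: 'v
    using conn_closed[of "{}" x y "{x}"] by auto
  then have "{w \<in> V. conn {} q w} = {q}" if "q \<in> V" for q
    using that by auto
  then have "comp_size V {} q = 1" if "q \<in> V" for q
    using that by (simp add: comp_size_def)
  then show ?case by (simp add: deg_def)
next
  case (insert e F)
  obtain u v where e: "e = {u, v}" "u \<noteq> v" "u \<in> V" "v \<in> V"
    using insert.prems(2)[of e] by (auto simp: card_2_iff)
  have F: "is_forest F" "\<not> conn F u v"
    using insert.prems(1) insert.hyps e is_forest_insert_iff[of u v F] by auto
  have h: "h x = h y" if "conn F x y" for x y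
    by (rule insert.prems(3)) (rule conn_mono[OF that], auto)
  have huv: "h u = h v" by (rule insert.prems(3)) (auto simp: e intro: conn_edge)
  have IH: "(\<Sum>q\<in>V. deg V F q * h q) = 2 * (\<Sum>q\<in>V. h q * (1 - 1 / comp_size V F q))"
    using insert F h by blast
  let ?C = "\<lambda>u. {w \<in> V. conn F u w}"
  let ?D = "?C u \<union> ?C v"
  have "\<not> (conn F u w \<and> conn F v w)" for w using F(2) conn_sym conn_trans by metis
  then have disj: "?C u \<inter> ?C v = {}" by auto
  have fin: "finite (?C u)" "finite (?C v)" using assms(1) by auto
  have cls: "{w \<in> V. conn (insert e F) q w} = (if q \<in> ?D then ?D else ?C q)" if "q \<in> V" for q
  proof (cases "q \<in> ?D")
    case True
    have "conn (insert e F) q w \<longleftrightarrow> conn F u w \<or> conn F v w" for w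
    proof -
      have cong: "conn F q w \<longleftrightarrow> conn F x w" "conn F q x" if "conn F x q" for x w
        using that conn_sym conn_trans by metis+
      from True consider "conn F u q" | "conn F v q" by auto
      then show ?thesis
        by cases (auto simp: e(1) conn_insert cong)
    qed
    with True show ?thesis by auto
  next
    case False
    then have "\<not> conn F q u" "\<not> conn F q v" using that conn_sym[of F] by auto
    then have "conn (insert e F) q w \<longleftrightarrow> conn F q w" for w
      unfolding e(1) conn_insert by simp
    with False show ?thesis by auto
  qed
  have size: "comp_size V (insert e F) q = (if q \<in> ?D then real (card ?D) else comp_size V F q)"
    if "q \<in> V" for q
    unfolding comp_size_def cls[OF that] by simp
  have "u \<in> ?D" using e by auto
  then have D: "real (card ?D) > 0" using fin by (auto simp: card_gt_0_iff)
  have "(\<Sum>q\<in>V. deg V (insert e F) q * h q)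
      = (\<Sum>q\<in>V. deg V F q * h q + (\<Sum>p\<in>V. of_bool ({p, q} = {u, v}) * h q))"
  proof (intro sum.cong refl)
    fix q
    have "deg V (insert e F) q = deg V F q + (\<Sum>p\<in>V. of_bool ({p, q} = {u, v}))"
      using insert.hyps(2) unfolding deg_def e(1) sum.distrib[symmetric]
      by (intro sum.cong) auto
    then show "deg V (insert e F) q * h q
        = deg V F q * h q + (\<Sum>p\<in>V. of_bool ({p, q} = {u, v}) * h q)"
      by (simp add: distrib_right sum_distrib_right)
  qed
  also have "\<dots> = 2 * (\<Sum>q\<in>V. h q * (1 - 1 / comp_size V F q)) + 2 * h u"
    using sum_doubleton_edge[OF assms(1) e(3,4,2), of h] huv IH by (simp add: sum.distrib)
  \<comment> \<open>Only the two components that \<open>e\<close> merges change size. On their union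
    the reciprocals add up to 2 before and to 1 after the insertion, and \<open>h\<close> has the
    constant value \<open>h u\<close> there.\<close>
  also have "2 * h u = 2 * (\<Sum>q\<in>V. h q / comp_size V F q - h q / comp_size V (insert e F) q)"
  proof -
    have "(\<Sum>q\<in>V. h q / comp_size V F q - h q / comp_size V (insert e F) q)
        = (\<Sum>q\<in>?D. h q / comp_size V F q - h q / comp_size V (insert e F) q)"
      by (rule sum.mono_neutral_right) (use assms(1) size in auto)
    also have "\<dots> = (\<Sum>q\<in>?D. h u * (1 / comp_size V F q - 1 / real (card ?D)))"
    proof (intro sum.cong refl)
      fix q assume q: "q \<in> ?D"
      then have "h q = h u" using h huv by auto
      moreover have "comp_size V (insert e F) q = real (card ?D)"
        using q size[of q] by auto
      ultimately show "h q / comp_size V F q - h q / comp_size V (insert e F) q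
          = h u * (1 / comp_size V F q - 1 / real (card ?D))" by (simp add: algebra_simps)
    qed
    also have "\<dots> = h u * ((\<Sum>q\<in>?D. 1 / comp_size V F q) - 1)"
      using D by (simp add: sum_distrib_left[symmetric] sum_subtractf)
    also have "(\<Sum>q\<in>?D. 1 / comp_size V F q) = 2"
      using sum_inverse_comp_size[OF assms(1)] e(3,4)
      by (simp add: sum.union_disjoint[OF fin disj])
    finally show ?thesis by simp
  qed
  also have "2 * (\<Sum>q\<in>V. h q * (1 - 1 / comp_size V F q))
      + 2 * (\<Sum>q\<in>V. h q / comp_size V F q - h q / comp_size V (insert e F) q)
      = 2 * (\<Sum>q\<in>V. h q * (1 - 1 / comp_size V (insert e F) q))"
    by (simp add: right_diff_distrib sum_subtractf)
  finally show ?case .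
qed

text \<open>Cauchy-Schwarz in the form of Lagrange's identity: the defect is half the sum of the
  nonnegative terms \<open>(c p - c q)^2 / (c p * c q)\<close>, so two different values of
  \<open>c\<close> make the inequality strict.\<close>

lemma sum_mult_sum_inverse:
  fixes c :: "'v \<Rightarrow> real"
  assumes "finite V" "\<And>q. q \<in> V \<Longrightarrow> 0 < c q"
  shows "(real (card V))\<^sup>2 \<le> (\<Sum>q\<in>V. c q) * (\<Sum>q\<in>V. 1 / c q)"
    and "p \<in> V \<Longrightarrow> q \<in> V \<Longrightarrow> c p \<noteq> c q \<Longrightarrow>
      (real (card V))\<^sup>2 < (\<Sum>q\<in>V. c q) * (\<Sum>q\<in>V. 1 / c q)"
proof -
  have eq: "2 * ((\<Sum>q\<in>V. c q) * (\<Sum>q\<in>V. 1 / c q) - (real (card V))\<^sup>2)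
      = (\<Sum>p\<in>V. \<Sum>q\<in>V. (c p - c q)\<^sup>2 / (c p * c q))" (is "_ = ?S")
  proof -
    have pointwise: "(c p - c q)\<^sup>2 / (c p * c q) = c p * (1 / c q) + c q * (1 / c p) - 2"
      if "p \<in> V" "q \<in> V" for p q
    proof -
      have "c p \<noteq> 0" "c q \<noteq> 0" using assms(2)[OF that(1)] assms(2)[OF that(2)] by auto
      then show ?thesis by (simp add: field_simps power2_eq_square)
    qed
    have "?S = (\<Sum>p\<in>V. \<Sum>q\<in>V. c p * (1 / c q) + c q * (1 / c p) - 2)"
      by (intro sum.cong refl) (rule pointwise; assumption)
    also have "\<dots> = (\<Sum>p\<in>V. \<Sum>q\<in>V. c p * (1 / c q)) + (\<Sum>p\<in>V. \<Sum>q\<in>V. c q * (1 / c p))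
        - 2 * (real (card V))\<^sup>2"
      by (simp only: sum_subtractf sum.distrib) (simp add: power2_eq_square)
    also have "(\<Sum>p\<in>V. \<Sum>q\<in>V. c q * (1 / c p)) = (\<Sum>p\<in>V. \<Sum>q\<in>V. c p * (1 / c q))"
      by (rule sum.swap)
    also have "(\<Sum>p\<in>V. \<Sum>q\<in>V. c p * (1 / c q)) = (\<Sum>q\<in>V. c q) * (\<Sum>q\<in>V. 1 / c q)"
      by (simp only: sum_product)
    finally show ?thesis by simp
  qed
  have pos: "0 \<le> (c p - c q)\<^sup>2 / (c p * c q)" if "p \<in> V" "q \<in> V" for p q
    using assms(2)[OF that(1)] assms(2)[OF that(2)] by simp
  have "0 \<le> ?S" by (intro sum_nonneg pos)
  then show "(real (card V))\<^sup>2 \<le> (\<Sum>q\<in>V. c q) * (\<Sum>q\<in>V. 1 / c q)" by (simp add: zero_le_mult_iff flip: eq)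
  assume pq: "p \<in> V" "q \<in> V" "c p \<noteq> c q"
  have "0 < ?S"
  proof (rule sum_pos2[OF assms(1) pq(1)])
    show "0 < (\<Sum>q\<in>V. (c p - c q)\<^sup>2 / (c p * c q))"
      by (rule sum_pos2[OF assms(1) pq(2)])
        (use pos pq assms(2)[of p] assms(2)[of q] in auto)
  qed (intro sum_nonneg pos)
  then show "(real (card V))\<^sup>2 < (\<Sum>q\<in>V. c q) * (\<Sum>q\<in>V. 1 / c q)" by (simp add: zero_less_mult_iff flip: eq)
qed

section \<open>Counting forests through two edges\<close>

lemma finite_complete_edges: "finite (complete_edges n)"
  by (rule finite_subset[of _ "Pow {1..n}"]) (auto simp: complete_edges_def)

lemma complete_edges_doubleton [simp]:
  "{x, y} \<in> complete_edges n \<longleftrightarrow> x \<in> {1..n} \<and> y \<in> {1..n} \<and> x \<noteq> y"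
  by (cases "x = y") (auto simp: complete_edges_def)

lemma finite_truncated_graphic_bases: "finite (truncated_graphic_bases n r)"
  by (rule finite_subset[of _ "Pow (complete_edges n)"])
    (auto simp: truncated_graphic_bases_def finite_complete_edges)

definition pair_count :: "nat \<Rightarrow> nat \<Rightarrow> nat set \<Rightarrow> nat set \<Rightarrow> nat" where
  "pair_count n r e f = card {B \<in> truncated_graphic_bases n r. e \<in> B \<and> f \<in> B}"

section \<open>Invariance of the counts under permutations of the vertices\<close>

lemma is_forest_image:
  assumes "bij \<pi>" "is_forest F"
  shows "is_forest ((`) \<pi> ` F)"
  unfolding is_forest_def
proof
  let ?i = "inv_into UNIV \<pi>"
  assume "\<exists>vs. is_cycle ((`) \<pi> ` F) vs"
  then obtain vs where vs: "is_cycle ((`) \<pi> ` F) vs" ..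
  have "is_cycle F (map ?i vs)"
    unfolding is_cycle_def
  proof (intro conjI allI impI)
    show "distinct (map ?i vs)"
      using vs inj_on_subset[OF bij_is_inj[OF bij_imp_bij_inv[OF assms(1)]], of "set vs"]
      by (simp add: is_cycle_def distinct_map)
    show "3 \<le> length (map ?i vs)" using vs by (simp add: is_cycle_def)
    fix i assume i: "i < length (map ?i vs)"
    with vs obtain e where e: "e \<in> F" "{vs ! i, vs ! (Suc i mod length vs)} = \<pi> ` e"
      by (auto simp: is_cycle_def)
    have "Suc i mod length vs < length vs" using i by (intro mod_less_divisor) auto
    then have "{map ?i vs ! i, map ?i vs ! (Suc i mod length (map ?i vs))}
        = ?i ` {vs ! i, vs ! (Suc i mod length vs)}"
      using i by simp
    also have "\<dots> = e" using assms(1) by (simp add: e image_inv_f_f bij_is_inj)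
    finally show "{map ?i vs ! i, map ?i vs ! (Suc i mod length (map ?i vs))} \<in> F"
      using e by simp
  qed
  with assms(2) show False by (auto simp: is_forest_def)
qed

lemma pair_count_le_image:
  assumes "bij \<pi>" "\<pi> ` {1..n} = {1..n}"
  shows "pair_count n r e f \<le> pair_count n r (\<pi> ` e) (\<pi> ` f)"
  unfolding pair_count_def
proof (rule card_inj_on_le[of "(`) ((`) \<pi>)"])
  have inj: "inj ((`) \<pi>)"
    by (rule injI) (simp add: inj_image_eq_iff bij_is_inj assms(1))
  then have "inj ((`) ((`) \<pi>))"
    by (intro injI) (simp add: inj_image_eq_iff)
  then show "inj_on ((`) ((`) \<pi>)) {B \<in> truncated_graphic_bases n r. e \<in> B \<and> f \<in> B}"
    by (rule inj_on_subset) simp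
  have "\<pi> ` e \<in> complete_edges n" if "e \<in> complete_edges n" for e
  proof -
    have "card (\<pi> ` e) = card e"
      by (rule card_image) (rule inj_on_subset[OF bij_is_inj[OF assms(1)]], simp)
    then show ?thesis using that assms(2) by (auto simp: complete_edges_def)
  qed
  moreover have "card ((`) \<pi> ` B) = card B" for B
    by (rule card_image) (rule inj_on_subset[OF inj], simp)
  ultimately show "(`) ((`) \<pi>) ` {B \<in> truncated_graphic_bases n r. e \<in> B \<and> f \<in> B}
      \<subseteq> {B \<in> truncated_graphic_bases n r. \<pi> ` e \<in> B \<and> \<pi> ` f \<in> B}"
    using is_forest_image[OF assms(1)] by (auto simp: truncated_graphic_bases_def)
qed (simp add: finite_truncated_graphic_bases)

text \<open>The inequality for \<open>\<pi>\<close> and the one for its inverse combine to an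
  equality.\<close>

lemma pair_count_image:
  assumes "bij \<pi>" "\<pi> ` {1..n} = {1..n}"
  shows "pair_count n r (\<pi> ` e) (\<pi> ` f) = pair_count n r e f"
proof (rule antisym)
  let ?i = "inv_into UNIV \<pi>"
  have cancel: "?i ` \<pi> ` A = A" for A using assms(1) by (simp add: image_inv_f_f bij_is_inj)
  have "?i ` {1..n} = {1..n}" using cancel[of "{1..n}"] assms(2) by simp
  from pair_count_le_image[OF bij_imp_bij_inv[OF assms(1)] this, of r "\<pi> ` e" "\<pi> ` f"]
  show "pair_count n r (\<pi> ` e) (\<pi> ` f) \<le> pair_count n r e f" by (simp add: cancel)
qed (rule pair_count_le_image[OF assms])

text \<open>A permutation that is already correct on the tails is followed by the transposition of
  \<open>\<pi> x\<close> and \<open>y\<close>. Neither of these occurs in \<open>ys\<close>, so the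
  tail stays correct.\<close>

lemma exists_permutation_map:
  assumes "length xs = length ys" "distinct xs" "distinct ys" "set xs \<subseteq> V" "set ys \<subseteq> V"
  shows "\<exists>\<pi>. bij \<pi> \<and> \<pi> ` V = V \<and> map \<pi> xs = ys"
  using assms
proof (induction xs ys rule: list_induct2)
  case Nil
  show ?case by (rule exI[of _ id]) (simp add: bij_def)
next
  case (Cons x xs y ys)
  then obtain \<pi> where \<pi>: "bij \<pi>" "\<pi> ` V = V" "map \<pi> xs = ys" by auto
  let ?\<sigma> = "transpose (\<pi> x) y"
  have "\<pi> x \<notin> set ys"
    using Cons.prems \<pi> by (auto simp: bij_is_inj inj_eq)
  then have "map ?\<sigma> ys = ys" using Cons.prems by (intro map_idI) (auto simp: transpose_def)
  then have "map (?\<sigma> \<circ> \<pi>) (x # xs) = y # ys" using \<pi>(3) by (auto simp flip: map_map)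
  moreover have "?\<sigma> ` V = V"
    using Cons.prems \<pi>(2) by (intro transpose_image_eq[THEN trans]) auto
  moreover have "bij (?\<sigma> \<circ> \<pi>)" using \<pi>(1) by (simp add: bij_comp)
  ultimately show ?case
    using \<pi>(2) by (metis image_comp)
qed

text \<open>The symmetric group is transitive on triples of distinct vertices, the middle one being
  the common vertex of the two edges.\<close>

lemma pair_count_adjacent:
  assumes "distinct [p, q, s]" "distinct [p', q', s']"
    "{p, q, s} \<subseteq> {1..n}" "{p', q', s'} \<subseteq> {1..n}"
  shows "pair_count n r {p, q} {q, s} = pair_count n r {p', q'} {q', s'}"
proof -
  have "\<exists>\<pi>. bij \<pi> \<and> \<pi> ` {1..n} = {1..n} \<and> map \<pi> [p, q, s] = [p', q', s']"
    by (rule exists_permutation_map) (use assms in auto)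
  then obtain \<pi> where "bij \<pi>" "\<pi> ` {1..n} = {1..n}" "map \<pi> [p, q, s] = [p', q', s']"
    by (elim exE conjE)
  then show ?thesis using pair_count_image[of \<pi> n r "{p, q}" "{q, s}"] by simp
qed

lemma pair_count_disjoint:
  assumes "distinct [p, q, s, t]" "distinct [p', q', s', t']"
    "{p, q, s, t} \<subseteq> {1..n}" "{p', q', s', t'} \<subseteq> {1..n}"
  shows "pair_count n r {p, q} {s, t} = pair_count n r {p', q'} {s', t'}"
proof -
  have "\<exists>\<pi>. bij \<pi> \<and> \<pi> ` {1..n} = {1..n} \<and> map \<pi> [p, q, s, t] = [p', q', s', t']"
    by (rule exists_permutation_map) (use assms in auto)
  then obtain \<pi> where "bij \<pi>" "\<pi> ` {1..n} = {1..n}" "map \<pi> [p, q, s, t] = [p', q', s', t']"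
    by (elim exE conjE)
  then show ?thesis using pair_count_image[of \<pi> n r "{p, q}" "{s, t}"] by simp
qed

text \<open>Deleting \<open>{x, y}\<close> from a forest leaves a forest with one edge less that
  separates \<open>x\<close> from \<open>y\<close>, and inserting the edge reverses this. As
  \<open>e\<close> differs from \<open>{x, y}\<close>, it survives the deletion.\<close>

lemma pair_count_eq_sum:
  assumes "e \<noteq> {x, y}" "x \<noteq> y" "x \<in> {1..n}" "y \<in> {1..n}"
  shows "real (pair_count n (Suc k) e {x, y})
    = (\<Sum>G\<in>truncated_graphic_bases n k. of_bool (e \<in> G) * of_bool (\<not> conn G x y))"
proof -
  let ?A = "{G \<in> truncated_graphic_bases n k. e \<in> G \<and> \<not> conn G x y}"
  let ?B = "{B \<in> truncated_graphic_bases n (Suc k). e \<in> B \<and> {x, y} \<in> B}"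
  have fin: "finite B" if "B \<subseteq> complete_edges n" for B
    using that finite_complete_edges finite_subset by blast
  have notin: "{x, y} \<notin> G" if "\<not> conn G x y" for G using that conn_edge[of x y G] by auto
  have "bij_betw (insert {x, y}) ?A ?B"
  proof (rule bij_betw_byWitness[where f' = "\<lambda>B. B - {{x, y}}"])
    show "\<forall>G\<in>?A. insert {x, y} G - {{x, y}} = G" using notin by auto
    show "\<forall>B\<in>?B. insert {x, y} (B - {{x, y}}) = B" by auto
    show "insert {x, y} ` ?A \<subseteq> ?B"
      using assms notin fin by (auto simp: truncated_graphic_bases_def is_forest_insert_iff)
    show "(\<lambda>B. B - {{x, y}}) ` ?B \<subseteq> ?A"
    proof (rule image_subsetI)
      fix B assume B: "B \<in> ?B"
      then have "is_forest (insert {x, y} (B - {{x, y}}))"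
        by (auto simp: truncated_graphic_bases_def insert_absorb)
      with is_forest_insert_iff[of x y "B - {{x, y}}"] B assms fin
      show "B - {{x, y}} \<in> ?A"
        by (auto simp: truncated_graphic_bases_def)
    qed
  qed
  then have "pair_count n (Suc k) e {x, y} = card ?A"
    unfolding pair_count_def by (simp add: bij_betw_same_card)
  also have "real \<dots> = (\<Sum>G\<in>truncated_graphic_bases n k. of_bool (e \<in> G \<and> \<not> conn G x y))"
    using finite_truncated_graphic_bases[of n k] by (simp add: of_bool_def sum.If_cases Int_def)
  finally show ?thesis by (simp add: of_bool_conj)
qed

text \<open>This makes the eigenvalue \<open>b - 2a\<close> negative.\<close>

lemma disjoint_lt_twice_adjacent:
  assumes "2 < r" "r < n"
  shows "pair_count n r {1, 2} {3, 4} < 2 * pair_count n r {1, 2} {2, 3}"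
proof -
  let ?\<G> = "truncated_graphic_bases n (r - 1)"
  let ?g = "\<lambda>G. of_bool ({1, 2} \<in> G) :: real"
  let ?s = "\<lambda>G x y. of_bool (\<not> conn G x y) :: real"
  have sum: "real (pair_count n r {1, 2} {x, y}) = (\<Sum>G\<in>?\<G>. ?g G * ?s G x y)"
    if "x \<in> {1..n}" "y \<in> {1..n}" "x \<noteq> y" "{1, 2} \<noteq> {x, y}" for x y
    using pair_count_eq_sum[of "{1, 2}" x y n "r - 1"] that assms by simp
  \<comment> \<open>The forest that makes the inequality strict: a star at 1 with the
    \<open>r - 2\<close> leaves 2, 5, ..., \<open>r + 1\<close>, and the separate edge
    \<open>{3, 4}\<close>. The largest vertex fits because \<open>r < n\<close>; for
    \<open>r = 3\<close> the interval is empty.\<close>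
  define I where "I = insert 2 {5..r+1}"
  define star :: "nat set set" where "star = (\<lambda>i. {1, i}) ` I"
  define G where "G = insert {3, 4} star"
  have I: "finite I" "1 \<notin> I" "card I = r - 2" "3 \<notin> I" "4 \<notin> I" "I \<subseteq> {1..n}"
    using assms by (auto simp: I_def)
  have "inj_on (\<lambda>i. {1, i}) I" by (auto simp: inj_on_def doubleton_eq_iff)
  then have "card star = r - 2" unfolding star_def using I by (simp add: card_image)
  moreover have "{3, 4} \<notin> star" "finite star" using I by (auto simp: star_def doubleton_eq_iff)
  ultimately have "card G = r - 1" using assms by (simp add: G_def)
  moreover have "is_forest G" unfolding G_def star_def
    using I by (intro is_forest_insert_leaf is_forest_star) auto
  moreover have "G \<subseteq> complete_edges n"
    using I assms by (auto simp: G_def star_def)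
  ultimately have G: "G \<in> ?\<G>" by (simp add: truncated_graphic_bases_def)
  have 12: "{1, 2} \<in> G" by (auto simp: G_def star_def I_def)
  have 34: "conn G 3 4" by (rule conn_edge) (simp add: G_def)
  have 31: "\<not> conn G 3 1"
  proof
    assume "conn G 3 1"
    then have "(1::nat) \<in> {3, 4}"
      by (rule conn_closed) (use I in \<open>auto simp: G_def star_def doubleton_eq_iff\<close>)
    then show False by simp
  qed
  then have 13: "\<not> conn G 1 3" using conn_sym[of G 1 3] by blast
  have "(\<Sum>G\<in>?\<G>. ?g G * ?s G 3 4) < (\<Sum>G\<in>?\<G>. ?g G * ?s G 1 3 + ?g G * ?s G 1 4)"
  proof (rule sum_strict_mono_ex1)
    show "\<forall>G\<in>?\<G>. ?g G * ?s G 3 4 \<le> ?g G * ?s G 1 3 + ?g G * ?s G 1 4"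
    proof
      fix G :: "nat set set"
      have "conn G 1 3 \<Longrightarrow> conn G 1 4 \<Longrightarrow> conn G 3 4" using conn_sym conn_trans by metis
      then show "?g G * ?s G 3 4 \<le> ?g G * ?s G 1 3 + ?g G * ?s G 1 4" by auto
    qed
    show "\<exists>G\<in>?\<G>. ?g G * ?s G 3 4 < ?g G * ?s G 1 3 + ?g G * ?s G 1 4"
      using 12 34 13 by (intro bexI[OF _ G]) simp
  qed (rule finite_truncated_graphic_bases)
  then have "real (pair_count n r {1, 2} {3, 4})
      < real (pair_count n r {1, 2} {1, 3}) + real (pair_count n r {1, 2} {1, 4})"
    using assms by (subst (1 2 3) sum) (auto simp: sum.distrib doubleton_eq_iff)
  moreover have "pair_count n r {1, 2} {1, 3} = pair_count n r {1, 2} {2, 3}"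
    using pair_count_adjacent[of 2 1 3 1 2 3 n r] assms by (simp add: insert_commute)
  moreover have "pair_count n r {1, 2} {1, 4} = pair_count n r {1, 2} {2, 3}"
    using pair_count_adjacent[of 2 1 4 1 2 3 n r] assms by (simp add: insert_commute)
  ultimately show ?thesis by linarith
qed

section \<open>Contribution of a single forest to the second inequality\<close>

lemma sum_separated:
  assumes "finite V"
  shows "(\<Sum>w\<in>V. of_bool (\<not> conn G q w)) = real (card V) - comp_size V G q"
proof -
  have "comp_size V G q = (\<Sum>w\<in>V. of_bool (conn G q w))"
    using assms by (simp add: comp_size_def of_bool_def sum.If_cases Int_def)
  then have "(\<Sum>w\<in>V. of_bool (\<not> conn G q w)) + comp_size V G q = (\<Sum>w\<in>V. 1 :: real)"
    by (simp add: sum.distrib[symmetric] of_bool_not_iff)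
  then show ?thesis by simp
qed

text \<open>The weight of \<open>q\<close> equals \<open>n * c(q) - S\<close>, where
  \<open>S\<close> is the sum of all \<open>c(q)\<close>. It is constant on components, so
  \<open>sum_deg_forest\<close> replaces the degrees by component sizes.\<close>

lemma forest_pair_excess:
  fixes V :: "'v set"
  assumes "finite V" "finite G" "is_forest G" "\<And>e. e \<in> G \<Longrightarrow> e \<subseteq> V \<and> card e = 2"
  shows "(\<Sum>q\<in>V. deg V G q * ((\<Sum>t\<in>V. \<Sum>w\<in>V. of_bool (\<not> conn G t w))
        - real (card V) * (\<Sum>w\<in>V. of_bool (\<not> conn G q w))))
    = 2 * ((\<Sum>q\<in>V. comp_size V G q) * (\<Sum>q\<in>V. 1 / comp_size V G q) - (real (card V))\<^sup>2)"
proof -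
  let ?n = "real (card V)"
  let ?c = "comp_size V G"
  let ?S = "\<Sum>q\<in>V. ?c q"
  have "(\<Sum>q\<in>V. deg V G q * ((\<Sum>t\<in>V. \<Sum>w\<in>V. of_bool (\<not> conn G t w))
        - ?n * (\<Sum>w\<in>V. of_bool (\<not> conn G q w))))
      = (\<Sum>q\<in>V. deg V G q * (?n * ?c q - ?S))"
    unfolding sum_separated[OF assms(1)] by (simp add: sum_subtractf algebra_simps)
  also have "\<dots> = 2 * (\<Sum>q\<in>V. (?n * ?c q - ?S) * (1 - 1 / ?c q))"
    using assms by (intro sum_deg_forest) (auto dest: comp_size_cong)
  also have "(\<Sum>q\<in>V. (?n * ?c q - ?S) * (1 - 1 / ?c q))
      = (\<Sum>q\<in>V. ?n * ?c q - ?S - ?n + ?S * (1 / ?c q))"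
  proof (intro sum.cong refl)
    fix q assume "q \<in> V"
    then have "?c q \<noteq> 0" using comp_size_pos[OF assms(1), of q G] by simp
    then show "(?n * ?c q - ?S) * (1 - 1 / ?c q) = ?n * ?c q - ?S - ?n + ?S * (1 / ?c q)"
      by (simp add: field_simps)
  qed
  \<comment> \<open>The terms \<open>n * c(q)\<close> and \<open>S\<close> cancel in the sum over
    all \<open>q\<close>.\<close>
  also have "\<dots> = ?S * (\<Sum>q\<in>V. 1 / ?c q) - ?n\<^sup>2"
    by (simp only: sum.distrib sum_subtractf sum_distrib_left[symmetric] sum_constant
        power2_eq_square)
  finally show ?thesis .
qed

lemma sum_Diff_doubleton:
  fixes f :: "'v \<Rightarrow> 'a::ab_group_add"
  assumes "finite V" "p \<in> V" "q \<in> V" "p \<noteq> q"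
  shows "sum f (V - {p, q}) = sum f V - f p - f q"
proof -
  have "sum f V = f p + (f q + sum f (V - {p} - {q}))"
    using assms by (simp add: sum.remove[of V p] sum.remove[of "V - {p}" q])
  moreover have "V - {p} - {q} = V - {p, q}" by auto
  ultimately show ?thesis by simp
qed

text \<open>The left side runs over the ordered paths \<open>p\<close>, \<open>q\<close>,
  \<open>t\<close> of \<open>pair_count_adjacent\<close>. Allowing \<open>t\<close> to be
  \<open>p\<close> or \<open>q\<close> changes nothing, since both are connected to
  \<open>q\<close>; allowing \<open>q = p\<close> changes nothing, since \<open>G\<close> has no
  loops.\<close>

lemma sum_adjacent_separated:
  fixes G :: "'v set set"
  assumes "finite V" "\<And>e. e \<in> G \<Longrightarrow> e \<subseteq> V \<and> card e = 2"
  shows "(\<Sum>p\<in>V. \<Sum>q\<in>V - {p}. \<Sum>t\<in>V - {p, q}. of_bool ({p, q} \<in> G) * of_bool (\<not> conn G q t))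
    = (\<Sum>q\<in>V. deg V G q * (\<Sum>t\<in>V. of_bool (\<not> conn G q t)))" (is "?lhs = ?rhs")
proof -
  have loopfree: "{p} \<notin> G" for p using assms(2)[of "{p}"] by auto
  let ?g = "\<lambda>p q. of_bool ({p, q} \<in> G) :: real"
  let ?s = "\<lambda>x y. of_bool (\<not> conn G x y) :: real"
  let ?D = "\<lambda>q. \<Sum>t\<in>V. ?s q t"
  have "?lhs = (\<Sum>p\<in>V. \<Sum>q\<in>V - {p}. ?g p q * ?D q)"
  proof (intro sum.cong refl)
    fix p q
    have "conn G q p" if "{p, q} \<in> G" using that conn_edge[of q p G] by (simp add: insert_commute)
    then have "(\<Sum>t\<in>V - {p, q}. ?g p q * ?s q t) = (\<Sum>t\<in>V. ?g p q * ?s q t)"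
      using assms(1) by (intro sum.mono_neutral_left) auto
    then show "(\<Sum>t\<in>V - {p, q}. ?g p q * ?s q t) = ?g p q * ?D q"
      by (simp only: sum_distrib_left)
  qed
  also have "\<dots> = (\<Sum>p\<in>V. \<Sum>q\<in>V. ?g p q * ?D q)"
    by (rule sum.cong[OF refl], rule sum.mono_neutral_left) (use assms(1) loopfree in auto)
  also have "\<dots> = ?rhs"
    unfolding deg_def sum_distrib_right by (rule sum.swap)
  finally show ?thesis .
qed

text \<open>For an edge \<open>{p, q}\<close> of \<open>G\<close>, excluding its ends from the
  ranges of \<open>t\<close> and \<open>w\<close> removes the row and the column sum of each end,
  and the entries between the ends vanish. This leaves \<open>W - 2 * D p - 2 * D q\<close>; by
  symmetry in \<open>p\<close> and \<open>q\<close> the total coefficient of \<open>D q\<close> is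
  4.\<close>

lemma sum_disjoint_separated:
  fixes G :: "'v set set"
  assumes "finite V" "\<And>e. e \<in> G \<Longrightarrow> e \<subseteq> V \<and> card e = 2"
  shows "(\<Sum>p\<in>V. \<Sum>q\<in>V - {p}. \<Sum>t\<in>V - {p, q}. \<Sum>w\<in>V - {p, q, t}.
      of_bool ({p, q} \<in> G) * of_bool (\<not> conn G t w))
    = (\<Sum>q\<in>V. deg V G q * ((\<Sum>t\<in>V. \<Sum>w\<in>V. of_bool (\<not> conn G t w))
        - 4 * (\<Sum>w\<in>V. of_bool (\<not> conn G q w))))" (is "?lhs = ?rhs")
proof -
  have loopfree: "{p} \<notin> G" for p using assms(2)[of "{p}"] by auto
  let ?g = "\<lambda>p q. of_bool ({p, q} \<in> G) :: real"
  let ?s = "\<lambda>x y. of_bool (\<not> conn G x y) :: real"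
  let ?D = "\<lambda>q. \<Sum>t\<in>V. ?s q t"
  let ?W = "\<Sum>t\<in>V. ?D t"
  have s_commute: "?s x y = ?s y x" for x y using conn_sym[of G] by auto
  have edge: "(\<Sum>t\<in>V - {p, q}. \<Sum>w\<in>V - {p, q, t}. ?s t w) = ?W - 2 * ?D p - 2 * ?D q"
    if "{p, q} \<in> G" for p q
  proof -
    have pq: "p \<in> V" "q \<in> V" "p \<noteq> q" using assms(2)[OF that] by auto
    have conn: "conn G p q" "conn G q p"
      using that by (auto intro: conn_edge simp: insert_commute)
    have "(\<Sum>w\<in>V - {p, q, t}. ?s t w) = ?D t - ?s p t - ?s q t" if "t \<in> V - {p, q}" for t
    proof -
      have "(\<Sum>w\<in>V - {p, q, t}. ?s t w) = (\<Sum>w\<in>V - {p, q}. ?s t w)"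
        using assms(1) by (intro sum.mono_neutral_left) auto
      also have "\<dots> = ?D t - ?s t p - ?s t q"
        by (rule sum_Diff_doubleton[OF assms(1) pq])
      finally show ?thesis by (simp only: s_commute[of t])
    qed
    then have "(\<Sum>t\<in>V - {p, q}. \<Sum>w\<in>V - {p, q, t}. ?s t w)
        = (\<Sum>t\<in>V - {p, q}. ?D t - ?s p t - ?s q t)" by (rule sum.cong[OF refl])
    also have "\<dots> = (\<Sum>t\<in>V. ?D t - ?s p t - ?s q t)
        - (?D p - ?s p p - ?s q p) - (?D q - ?s p q - ?s q q)"
      by (rule sum_Diff_doubleton[OF assms(1) pq])
    also have "\<dots> = ?W - 2 * ?D p - 2 * ?D q"
      unfolding sum_subtractf using conn by simp
    finally show ?thesis .
  qed
  have "?lhs = (\<Sum>p\<in>V. \<Sum>q\<in>V - {p}. ?g p q * (?W - 2 * ?D p - 2 * ?D q))"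
  proof (intro sum.cong refl)
    fix p q
    have "(\<Sum>t\<in>V - {p, q}. \<Sum>w\<in>V - {p, q, t}. ?g p q * ?s t w)
        = ?g p q * (\<Sum>t\<in>V - {p, q}. \<Sum>w\<in>V - {p, q, t}. ?s t w)"
      by (simp only: sum_distrib_left)
    also have "\<dots> = ?g p q * (?W - 2 * ?D p - 2 * ?D q)"
      by (cases "{p, q} \<in> G") (simp_all only: edge of_bool_eq mult_zero_left)
    finally show "(\<Sum>t\<in>V - {p, q}. \<Sum>w\<in>V - {p, q, t}. ?g p q * ?s t w)
        = ?g p q * (?W - 2 * ?D p - 2 * ?D q)" .
  qed
  also have "\<dots> = (\<Sum>p\<in>V. \<Sum>q\<in>V. ?g p q * (?W - 2 * ?D p - 2 * ?D q))"
    by (rule sum.cong[OF refl], rule sum.mono_neutral_left) (use assms(1) loopfree in auto)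
  also have "\<dots> = (\<Sum>p\<in>V. \<Sum>q\<in>V. ?g p q * (?W - 2 * ?D q)) - 2 * (\<Sum>p\<in>V. \<Sum>q\<in>V. ?g p q * ?D p)"
    by (simp only: sum_distrib_left sum_subtractf[symmetric] right_diff_distrib algebra_simps)
  also have "(\<Sum>p\<in>V. \<Sum>q\<in>V. ?g p q * ?D p) = (\<Sum>q\<in>V. deg V G q * ?D q)"
    unfolding deg_def sum_distrib_right by (simp only: insert_commute)
  also have "(\<Sum>p\<in>V. \<Sum>q\<in>V. ?g p q * (?W - 2 * ?D q)) = (\<Sum>q\<in>V. deg V G q * (?W - 2 * ?D q))"
    unfolding deg_def sum_distrib_right by (rule sum.swap)
  also have "(\<Sum>q\<in>V. deg V G q * (?W - 2 * ?D q)) - 2 * (\<Sum>q\<in>V. deg V G q * ?D q) = ?rhs"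
    unfolding sum_distrib_left[of 2 "\<lambda>q. deg V G q * ?D q"] sum_subtractf[symmetric]
    by (intro sum.cong refl) (simp only: algebra_simps)
  finally show ?thesis .
qed

text \<open>This makes the eigenvalue \<open>(n - 4)a - (n - 3)b\<close> negative.\<close>

lemma adjacent_lt_disjoint:
  assumes "2 < r" "r < n"
  shows "(real n - 4) * real (pair_count n r {1, 2} {2, 3})
    < (real n - 3) * real (pair_count n r {1, 2} {3, 4})"
proof -
  define V where "V = {1..n}"
  let ?\<G> = "truncated_graphic_bases n (r - 1)"
  let ?g = "\<lambda>G p q. of_bool ({p, q} \<in> G) :: real"
  let ?s = "\<lambda>G x y. of_bool (\<not> conn G x y) :: real"
  let ?a = "real (pair_count n r {1, 2} {2, 3})"
  let ?b = "real (pair_count n r {1, 2} {3, 4})"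
  \<comment> \<open>\<open>D G q\<close> counts the vertices outside the component of
    \<open>q\<close>. By the two preceding lemmas \<open>Y G\<close> and \<open>X G\<close> are the
    contributions of \<open>G\<close> to the counts of adjacent and of disjoint ordered edge pairs;
    summed over all \<open>G\<close> they give multiples of \<open>a\<close> and
    \<open>b\<close>.\<close>
  define D where "D = (\<lambda>G q. \<Sum>t\<in>V. ?s G q t)"
  define Y where "Y = (\<lambda>G. \<Sum>q\<in>V. deg V G q * D G q)"
  define X where "X = (\<lambda>G. \<Sum>q\<in>V. deg V G q * ((\<Sum>t\<in>V. D G t) - 4 * D G q))"
  have V: "finite V" "card V = n" by (simp_all add: V_def)
  have card1: "real (card (V - {p})) = real n - 1" if "p \<in> V" for p
    using card.remove[OF V(1) that] V(2) by linarith
  have card2: "real (card (V - {p, q})) = real n - 2" if "p \<in> V" "q \<in> V - {p}" for p q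
    using sum_Diff_doubleton[of V p q "\<lambda>_. 1 :: real"] that V by auto
  have card3: "real (card (V - {p, q, t})) = real n - 3" if "p \<in> V" "q \<in> V - {p}" "t \<in> V - {p, q}" for p q t
  proof -
    have "V - {p, q, t} = (V - {p, q}) - {t}" by auto
    then have "card (V - {p, q}) = Suc (card (V - {p, q, t}))"
      using card.remove[OF _ that(3)] V(1) by simp
    with card2[OF that(1,2)] show ?thesis by linarith
  qed
  have triples: "(\<Sum>p\<in>V. \<Sum>q\<in>V - {p}. \<Sum>t\<in>V - {p, q}. z)
      = real n * (real n - 1) * (real n - 2) * z" for z
  proof -
    have "(\<Sum>p\<in>V. \<Sum>q\<in>V - {p}. \<Sum>t\<in>V - {p, q}. z) = (\<Sum>p\<in>V. \<Sum>q\<in>V - {p}. (real n - 2) * z)"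
      by (intro sum.cong refl) (simp only: sum_constant card2)
    also have "\<dots> = (\<Sum>p\<in>V. (real n - 1) * ((real n - 2) * z))"
      by (intro sum.cong refl) (simp only: sum_constant card1)
    finally show ?thesis by (simp add: V)
  qed
  have forest: "is_forest G" "finite G" "\<And>e. e \<in> G \<Longrightarrow> e \<subseteq> V \<and> card e = 2" if "G \<in> ?\<G>" for G
    using that finite_subset[OF _ finite_complete_edges[of n], of G]
    by (auto simp: truncated_graphic_bases_def complete_edges_def V_def)
  have count: "real (pair_count n r {p, q} {x, y}) = (\<Sum>G\<in>?\<G>. ?g G p q * ?s G x y)"
    if "x \<in> V" "y \<in> V" "x \<noteq> y" "{p, q} \<noteq> {x, y}" for p q x y
    using pair_count_eq_sum[of "{p, q}" x y n "r - 1"] that assms by (simp add: V_def)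
  have "(\<Sum>G\<in>?\<G>. Y G) = (\<Sum>G\<in>?\<G>. \<Sum>p\<in>V. \<Sum>q\<in>V - {p}. \<Sum>t\<in>V - {p, q}. ?g G p q * ?s G q t)"
    unfolding Y_def D_def by (intro sum.cong refl sum_adjacent_separated[symmetric] V forest(3))
  also have "\<dots> = (\<Sum>p\<in>V. \<Sum>q\<in>V - {p}. \<Sum>t\<in>V - {p, q}. \<Sum>G\<in>?\<G>. ?g G p q * ?s G q t)"
    by (simp only: sum.swap[of _ _ ?\<G>])
  also have "\<dots> = (\<Sum>p\<in>V. \<Sum>q\<in>V - {p}. \<Sum>t\<in>V - {p, q}. ?a)"
  proof (intro sum.cong refl)
    fix p q t assume *: "p \<in> V" "q \<in> V - {p}" "t \<in> V - {p, q}"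
    then have "(\<Sum>G\<in>?\<G>. ?g G p q * ?s G q t) = real (pair_count n r {p, q} {q, t})"
      by (intro count[symmetric]) (auto simp: doubleton_eq_iff)
    also have "\<dots> = ?a"
      using pair_count_adjacent[of p q t 1 2 3 n r] * assms by (auto simp: V_def)
    finally show "(\<Sum>G\<in>?\<G>. ?g G p q * ?s G q t) = ?a" .
  qed
  also have "\<dots> = real n * (real n - 1) * (real n - 2) * ?a"
    by (rule triples)
  finally have sumY: "(\<Sum>G\<in>?\<G>. Y G) = real n * (real n - 1) * (real n - 2) * ?a" .
  have "(\<Sum>G\<in>?\<G>. X G) = (\<Sum>G\<in>?\<G>. \<Sum>p\<in>V. \<Sum>q\<in>V - {p}. \<Sum>t\<in>V - {p, q}. \<Sum>w\<in>V - {p, q, t}. ?g G p q * ?s G t w)"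
    unfolding X_def D_def by (intro sum.cong refl sum_disjoint_separated[symmetric] V forest(3))
  also have "\<dots> = (\<Sum>p\<in>V. \<Sum>q\<in>V - {p}. \<Sum>t\<in>V - {p, q}. \<Sum>w\<in>V - {p, q, t}. \<Sum>G\<in>?\<G>. ?g G p q * ?s G t w)"
    by (simp only: sum.swap[of _ _ ?\<G>])
  also have "\<dots> = (\<Sum>p\<in>V. \<Sum>q\<in>V - {p}. \<Sum>t\<in>V - {p, q}. \<Sum>w\<in>V - {p, q, t}. ?b)"
  proof (intro sum.cong refl)
    fix p q t w assume *: "p \<in> V" "q \<in> V - {p}" "t \<in> V - {p, q}" "w \<in> V - {p, q, t}"
    then have "(\<Sum>G\<in>?\<G>. ?g G p q * ?s G t w) = real (pair_count n r {p, q} {t, w})"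
      by (intro count[symmetric]) (auto simp: doubleton_eq_iff)
    also have "\<dots> = ?b"
      using pair_count_disjoint[of p q t w 1 2 3 4 n r] * assms by (auto simp: V_def)
    finally show "(\<Sum>G\<in>?\<G>. ?g G p q * ?s G t w) = ?b" .
  qed
  also have "\<dots> = real n * (real n - 1) * (real n - 2) * (real n - 3) * ?b"
  proof -
    have "(\<Sum>p\<in>V. \<Sum>q\<in>V - {p}. \<Sum>t\<in>V - {p, q}. \<Sum>w\<in>V - {p, q, t}. ?b)
        = (\<Sum>p\<in>V. \<Sum>q\<in>V - {p}. \<Sum>t\<in>V - {p, q}. (real n - 3) * ?b)"
      by (intro sum.cong refl) (simp only: sum_constant card3)
    then show ?thesis by (simp only: triples mult.assoc)
  qed
  finally have sumX: "(\<Sum>G\<in>?\<G>. X G) = real n * (real n - 1) * (real n - 2) * (real n - 3) * ?b" .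
  let ?c = "\<lambda>G. comp_size V G"
  \<comment> \<open>The factor \<open>n - 4\<close> is chosen so that, together with the 4 inside
    \<open>X\<close>, it produces the factor \<open>card V\<close> of
    \<open>forest_pair_excess\<close>.\<close>
  have excess: "X G - (real n - 4) * Y G
      = 2 * ((\<Sum>q\<in>V. ?c G q) * (\<Sum>q\<in>V. 1 / ?c G q) - (real n)\<^sup>2)" if "G \<in> ?\<G>" for G
  proof -
    have "X G - (real n - 4) * Y G = (\<Sum>q\<in>V. deg V G q * ((\<Sum>t\<in>V. D G t) - real (card V) * D G q))"
      unfolding X_def Y_def sum_distrib_left[of "real n - 4"] sum_subtractf[symmetric] V(2)
      by (intro sum.cong refl) (simp only: algebra_simps)
    also have "\<dots> = 2 * ((\<Sum>q\<in>V. ?c G q) * (\<Sum>q\<in>V. 1 / ?c G q) - (real n)\<^sup>2)"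
      unfolding D_def using forest_pair_excess[OF V(1) forest(2,1,3)[OF that]] V(2) by simp
    finally show ?thesis .
  qed
  \<comment> \<open>A star with \<open>r - 1\<close> edges. As \<open>r < n\<close>, the vertex
    \<open>n\<close> is isolated, while the component of 1 has at least two vertices; so the
    component sizes are not all equal.\<close>
  define G where "G = (\<lambda>i. {1, i}) ` {2..r}"
  have "inj_on (\<lambda>i. {1, i}) {2..r}" by (auto simp: inj_on_def doubleton_eq_iff)
  then have "card G = r - 1" unfolding G_def using assms by (simp add: card_image)
  moreover have "is_forest G" unfolding G_def by (rule is_forest_star) auto
  moreover have "G \<subseteq> complete_edges n" using assms by (auto simp: G_def)
  ultimately have G: "G \<in> ?\<G>" by (simp add: truncated_graphic_bases_def)
  have "y = n" if "conn G n y" for y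
  proof -
    from that have "y \<in> {n}"
      by (rule conn_closed) (use assms in \<open>auto simp: G_def doubleton_eq_iff\<close>)
    then show ?thesis by simp
  qed
  then have "{w \<in> V. conn G n w} = {n}" using assms by (auto simp: V_def)
  then have cn: "?c G n = 1" by (simp add: comp_size_def)
  have "{1, 2} \<in> G" using assms by (auto simp: G_def)
  then have "{1, 2} \<subseteq> {w \<in> V. conn G 1 w}" using assms by (auto simp: V_def intro: conn_edge)
  then have "card {1, 2::nat} \<le> card {w \<in> V. conn G 1 w}" by (rule card_mono[rotated]) (simp add: V)
  then have c1: "?c G 1 \<noteq> ?c G n" using cn by (simp add: comp_size_def)
  have cpos: "0 < ?c G q" if "q \<in> V" for G q using comp_size_pos[OF V(1) that] .
  have "0 < (\<Sum>G\<in>?\<G>. X G - (real n - 4) * Y G)"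
  proof (rule sum_pos2[OF finite_truncated_graphic_bases G])
    show "0 < X G - (real n - 4) * Y G"
      using sum_mult_sum_inverse(2)[OF V(1) cpos _ _ c1] excess[OF G] V assms by (simp add: V_def)
    show "0 \<le> X H - (real n - 4) * Y H" if "H \<in> ?\<G>" for H
      using sum_mult_sum_inverse(1)[of V "?c H", OF V(1) cpos] excess[OF that] V by simp
  qed
  also have "\<dots> = (\<Sum>G\<in>?\<G>. X G) - (real n - 4) * (\<Sum>G\<in>?\<G>. Y G)"
    by (simp only: sum_subtractf sum_distrib_left)
  also have "\<dots> = real n * (real n - 1) * (real n - 2) * ((real n - 3) * ?b - (real n - 4) * ?a)"
    unfolding sumX sumY by (simp only: algebra_simps)
  finally have "0 < real n * (real n - 1) * (real n - 2) * ((real n - 3) * ?b - (real n - 4) * ?a)" .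
  moreover have "0 < real n * (real n - 1) * (real n - 2)"
    using assms by (intro mult_pos_pos) auto
  ultimately have "0 < (real n - 3) * ?b - (real n - 4) * ?a" by (rule zero_less_mult_pos)
  then show ?thesis by linarith
qed

section \<open>The association scheme of edges\<close>

text \<open>The vertex-edge incidence matrix of \<open>K_n\<close> applied to \<open>x\<close>; its
  transpose sends \<open>y\<close> to the function \<open>\<Sum>v\<in>e. y v\<close> of the edge
  \<open>e\<close>.\<close>

definition star_sum :: "nat \<Rightarrow> (nat set \<Rightarrow> 'k::comm_monoid_add) \<Rightarrow> nat \<Rightarrow> 'k" where
  "star_sum n x v = (\<Sum>e | e \<in> complete_edges n \<and> v \<in> e. x e)"

lemma sum_star:
  assumes "u \<in> {1..n}"
  shows "(\<Sum>e | e \<in> complete_edges n \<and> u \<in> e. f e) = (\<Sum>w\<in>{1..n} - {u}. f {u, w})"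
proof -
  have "{e. e \<in> complete_edges n \<and> u \<in> e} = (\<lambda>w. {u, w}) ` ({1..n} - {u})"
  proof (intro equalityI subsetI)
    fix e assume e: "e \<in> {e. e \<in> complete_edges n \<and> u \<in> e}"
    then obtain x y where xy: "e = {x, y}" "x \<noteq> y" by (auto simp: complete_edges_def card_2_iff)
    with e show "e \<in> (\<lambda>w. {u, w}) ` ({1..n} - {u})" by (auto simp: insert_commute)
  qed (use assms in auto)
  moreover have "inj_on (\<lambda>w. {u, w}) ({1..n} - {u})" by (auto simp: inj_on_def doubleton_eq_iff)
  ultimately show ?thesis by (simp add: sum.reindex)
qed

lemma star_sum_add: "star_sum n (\<lambda>e. f e + g e) v = star_sum n f v + star_sum n g v"
  by (simp add: star_sum_def sum.distrib)

lemma star_sum_mult: "star_sum n (\<lambda>e. c * f e) v = (c :: 'k::semiring_0) * star_sum n f v"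
  by (simp add: star_sum_def sum_distrib_left)

lemma star_sum_const:
  assumes "u \<in> {1..n}"
  shows "star_sum n (\<lambda>_. c :: 'k::comm_ring_1) u = (of_nat n - 1) * c"
proof -
  have "card {1..n} = Suc (card ({1..n} - {u}))" using assms by (intro card.remove) auto
  then have "of_nat (card ({1..n} - {u})) = (of_nat n - 1 :: 'k)"
    by (metis add_diff_cancel_left' card_atLeastAtMost diff_Suc_1 of_nat_Suc)
  moreover have "star_sum n (\<lambda>_. c) u = (\<Sum>w\<in>{1..n} - {u}. c)"
    unfolding star_sum_def by (rule sum_star[OF assms])
  ultimately show ?thesis by (simp only: sum_constant)
qed

text \<open>The incidence matrix times its transpose is \<open>(n - 2) I + J\<close>: a vertex lies
  on \<open>n - 1\<close> edges and shares exactly one with every other vertex.\<close>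

lemma star_sum_ends:
  fixes y :: "nat \<Rightarrow> 'k::comm_ring_1"
  assumes "u \<in> {1..n}"
  shows "star_sum n (\<lambda>e. \<Sum>v\<in>e. y v) u = (of_nat n - 2) * y u + (\<Sum>v\<in>{1..n}. y v)"
proof -
  have "star_sum n (\<lambda>e. \<Sum>v\<in>e. y v) u = (\<Sum>w\<in>{1..n} - {u}. \<Sum>v\<in>{u, w}. y v)"
    unfolding star_sum_def by (rule sum_star[OF assms])
  also have "\<dots> = (\<Sum>w\<in>{1..n} - {u}. y u + y w)" by (rule sum.cong) auto
  also have "\<dots> = star_sum n (\<lambda>_. y u) u + (\<Sum>w\<in>{1..n} - {u}. y w)"
    by (simp only: sum.distrib star_sum_def sum_star[OF assms])
  also have "\<dots> = (of_nat n - 1) * y u + ((\<Sum>v\<in>{1..n}. y v) - y u)"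
    using assms by (simp add: star_sum_const sum_diff1)
  finally show ?thesis by (simp add: algebra_simps)
qed

text \<open>Double counting of the incident pairs of a vertex and an edge.\<close>

lemma sum_star_sum:
  "(\<Sum>v\<in>{1..n}. star_sum n (\<lambda>e. x e * y v) v) = (\<Sum>e\<in>complete_edges n. x e * (\<Sum>v\<in>e. y v))"
    for x :: "nat set \<Rightarrow> 'k::comm_ring_1"
proof -
  have "(\<Sum>v\<in>{1..n}. star_sum n (\<lambda>e. x e * y v) v)
      = (\<Sum>v\<in>{1..n}. \<Sum>e\<in>complete_edges n. if v \<in> e then x e * y v else 0)"
    by (simp add: star_sum_def sum.inter_filter[OF finite_complete_edges])
  also have "\<dots> = (\<Sum>e\<in>complete_edges n. \<Sum>v\<in>{1..n}. if v \<in> e then x e * y v else 0)"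
    by (rule sum.swap)
  also have "\<dots> = (\<Sum>e\<in>complete_edges n. x e * (\<Sum>v\<in>e. y v))"
  proof (rule sum.cong[OF refl])
    fix e assume "e \<in> complete_edges n"
    then have "{v \<in> {1..n}. v \<in> e} = e" by (auto simp: complete_edges_def)
    then show "(\<Sum>v\<in>{1..n}. if v \<in> e then x e * y v else 0) = x e * (\<Sum>v\<in>e. y v)"
      by (simp add: sum.inter_filter[symmetric] sum_distrib_left)
  qed
  finally show ?thesis .
qed

lemma sum_star_sum_eq: "(\<Sum>v\<in>{1..n}. star_sum n x v) = 2 * (\<Sum>e\<in>complete_edges n. x e)"
    for x :: "nat set \<Rightarrow> 'k::comm_ring_1"
proof -
  have "(\<Sum>v\<in>{1..n}. star_sum n x v) = (\<Sum>e\<in>complete_edges n. x e * (\<Sum>v\<in>e. 1))"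
    using sum_star_sum[of n x "\<lambda>_. 1"] by simp
  also have "\<dots> = (\<Sum>e\<in>complete_edges n. 2 * x e)"
    by (rule sum.cong) (auto simp: complete_edges_def)
  finally show ?thesis by (simp add: sum_distrib_left)
qed

lemma sum_ends: "(\<Sum>e\<in>complete_edges n. \<Sum>v\<in>e. y v) = (of_nat n - 1) * (\<Sum>v\<in>{1..n}. y v)"
    for y :: "nat \<Rightarrow> 'k::comm_ring_1"
  using sum_star_sum[of n "\<lambda>_. 1" y] by (simp add: star_sum_const sum_distrib_left)

lemma card_complete_edges: "2 * of_nat (card (complete_edges n)) = (of_nat n * (of_nat n - 1) :: 'k::comm_ring_1)"
  using sum_star_sum_eq[of n "\<lambda>_. 1 :: 'k"] by (simp add: star_sum_const)

text \<open>The algebra of the association scheme of pairs of edges of \<open>K\<^sub>n\<close> (equal, adjacent, disjoint);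
  its three characters are \<open>\<alpha>\<close>, \<open>\<alpha> + (n - 2) \<beta>\<close> and \<open>\<alpha> + 2 (n - 1) \<beta> + n (n - 1) \<gamma> / 2\<close>.\<close>

definition scheme_op :: "nat \<Rightarrow> 'k::comm_ring_1 \<Rightarrow> 'k \<Rightarrow> 'k \<Rightarrow> (nat set \<Rightarrow> 'k) \<Rightarrow> nat set \<Rightarrow> 'k" where
  "scheme_op n \<alpha> \<beta> \<gamma> x e =
     \<alpha> * x e + \<beta> * (\<Sum>v\<in>e. star_sum n x v) + \<gamma> * (\<Sum>f\<in>complete_edges n. x f)"

text \<open>The three nonzero characters are used one after the other: summing over all edges kills
  the total of \<open>x\<close>, summing over a star then kills its star sums, and what remains is
  \<open>\<alpha> * x e = 0\<close>. The third assumption is twice the third character, which avoids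
  halving.\<close>

lemma scheme_op_inj:
  fixes \<alpha> \<beta> \<gamma> :: "'k::field_char_0"
  assumes "\<alpha> \<noteq> 0" "\<alpha> + (of_nat n - 2) * \<beta> \<noteq> 0"
    "2 * \<alpha> + 4 * (of_nat n - 1) * \<beta> + of_nat n * (of_nat n - 1) * \<gamma> \<noteq> 0"
    and zero: "\<And>e. e \<in> complete_edges n \<Longrightarrow> scheme_op n \<alpha> \<beta> \<gamma> x e = 0"
    and "e \<in> complete_edges n"
  shows "x e = 0"
proof -
  let ?T = "\<Sum>f\<in>complete_edges n. x f"
  have "0 = (\<Sum>e\<in>complete_edges n. scheme_op n \<alpha> \<beta> \<gamma> x e)" using zero by simp
  also have "\<dots> = \<alpha> * ?T + \<beta> * ((of_nat n - 1) * (2 * ?T)) + of_nat (card (complete_edges n)) * \<gamma> * ?T"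
    unfolding scheme_op_def sum.distrib sum_distrib_left[symmetric] sum_ends sum_star_sum_eq by simp
  finally have "0 = 2 * (\<alpha> * ?T + \<beta> * ((of_nat n - 1) * (2 * ?T))
      + of_nat (card (complete_edges n)) * \<gamma> * ?T)" by simp
  also have "\<dots> = (2 * \<alpha> + 4 * (of_nat n - 1) * \<beta> + 2 * of_nat (card (complete_edges n)) * \<gamma>) * ?T"
    by (simp add: algebra_simps)
  finally have "(2 * \<alpha> + 4 * (of_nat n - 1) * \<beta> + of_nat n * (of_nat n - 1) * \<gamma>) * ?T = 0"
    unfolding card_complete_edges by simp
  then have T: "?T = 0" using assms by simp
  have S: "star_sum n x u = 0" if u: "u \<in> {1..n}" for u
  proof -
    have "0 = star_sum n (scheme_op n \<alpha> \<beta> \<gamma> x) u" using zero by (simp add: star_sum_def)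
    also have "\<dots> = \<alpha> * star_sum n x u + \<beta> * ((of_nat n - 2) * star_sum n x u)"
      unfolding scheme_op_def star_sum_add star_sum_mult star_sum_ends[OF u] sum_star_sum_eq T
      by (simp add: star_sum_def)
    finally have "(\<alpha> + (of_nat n - 2) * \<beta>) * star_sum n x u = 0" by (simp add: algebra_simps)
    then show ?thesis using assms by simp
  qed
  have "(\<Sum>v\<in>e. star_sum n x v) = 0"
    using S assms(5) by (intro sum.neutral) (auto simp: complete_edges_def)
  then have "\<alpha> * x e = 0" using zero[OF assms(5)] T by (simp add: scheme_op_def)
  then show ?thesis using assms by simp
qed

text \<open>The system is solved explicitly in the order of the injectivity proof: first the total
  \<open>t\<close> of the solution, then its star sums \<open>\<sigma>\<close>, then the solution
  itself. It remains to verify that \<open>x\<close> really has this total and these star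
  sums.\<close>

lemma scheme_op_surj:
  fixes \<alpha> \<beta> \<gamma> :: "'k::field_char_0"
  assumes "\<alpha> \<noteq> 0" "\<alpha> + (of_nat n - 2) * \<beta> \<noteq> 0"
    "2 * \<alpha> + 4 * (of_nat n - 1) * \<beta> + of_nat n * (of_nat n - 1) * \<gamma> \<noteq> 0"
  shows "\<exists>x. \<forall>e\<in>complete_edges n. scheme_op n \<alpha> \<beta> \<gamma> x e = y e"
proof -
  define l0 where "l0 = 2 * \<alpha> + 4 * (of_nat n - 1) * \<beta> + of_nat n * (of_nat n - 1) * \<gamma>"
  define l1 where "l1 = \<alpha> + (of_nat n - 2) * \<beta>"
  have nz: "l0 \<noteq> 0" "l1 \<noteq> 0" using assms by (auto simp: l0_def l1_def)
  let ?Y = "\<Sum>f\<in>complete_edges n. y f"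
  define t where "t = 2 * ?Y / l0"
  define \<sigma> where "\<sigma> v = (star_sum n y v - (2 * \<beta> + (of_nat n - 1) * \<gamma>) * t) / l1" for v
  define x where "x e = (1 / \<alpha>) * y e + (- \<beta> / \<alpha>) * (\<Sum>v\<in>e. \<sigma> v) + (- \<gamma> * t / \<alpha>)" for e
  have t: "2 * ?Y = l0 * t" using nz by (simp add: t_def)
  have \<sigma>: "star_sum n y v = l1 * \<sigma> v + (2 * \<beta> + (of_nat n - 1) * \<gamma>) * t" for v
    using nz by (simp add: \<sigma>_def)
  have "2 * ?Y = (\<Sum>v\<in>{1..n}. l1 * \<sigma> v + (2 * \<beta> + (of_nat n - 1) * \<gamma>) * t)"
    unfolding sum_star_sum_eq[symmetric] \<sigma> ..
  also have "\<dots> = l1 * (\<Sum>v\<in>{1..n}. \<sigma> v) + of_nat n * (2 * \<beta> + (of_nat n - 1) * \<gamma>) * t"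
    unfolding sum.distrib sum_distrib_left[symmetric] by simp
  finally have "l1 * (\<Sum>v\<in>{1..n}. \<sigma> v) = l0 * t - of_nat n * (2 * \<beta> + (of_nat n - 1) * \<gamma>) * t"
    unfolding t by simp
  \<comment> \<open>Consistency of the guesses:
    \<open>l0 - n * (2 * \<beta> + (n - 1) * \<gamma>)\<close> equals \<open>2 * l1\<close>, so the
    \<open>\<sigma> v\<close> add up to \<open>2 * t\<close>, as star sums of a function with total
    \<open>t\<close> must.\<close>
  also have "\<dots> = l1 * (2 * t)"
    unfolding l0_def l1_def by (simp add: algebra_simps)
  finally have "l1 * (\<Sum>v\<in>{1..n}. \<sigma> v) = l1 * (2 * t)" .
  then have sum\<sigma>: "(\<Sum>v\<in>{1..n}. \<sigma> v) = 2 * t" using nz by simp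
  have star_x: "star_sum n x v = \<sigma> v" if v: "v \<in> {1..n}" for v
  proof -
    have "star_sum n x v = (1 / \<alpha>) * star_sum n y v
        + (- \<beta> / \<alpha>) * ((of_nat n - 2) * \<sigma> v + 2 * t) + (of_nat n - 1) * (- \<gamma> * t / \<alpha>)"
      unfolding x_def star_sum_add star_sum_mult star_sum_ends[OF v] star_sum_const[OF v] sum\<sigma> ..
    also have "\<dots> = (star_sum n y v - \<beta> * ((of_nat n - 2) * \<sigma> v + 2 * t) - (of_nat n - 1) * \<gamma> * t) / \<alpha>"
      using assms(1) by (simp add: field_simps)
    also have "star_sum n y v - \<beta> * ((of_nat n - 2) * \<sigma> v + 2 * t) - (of_nat n - 1) * \<gamma> * t = \<alpha> * \<sigma> v"
      unfolding \<sigma> l1_def by (simp add: algebra_simps)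
    finally show ?thesis using assms(1) by simp
  qed
  have "2 * (\<Sum>e\<in>complete_edges n. x e) = 2 * t"
    unfolding sum_star_sum_eq[symmetric] sum\<sigma>[symmetric] by (rule sum.cong) (simp_all only: star_x)
  then have sum_x: "(\<Sum>e\<in>complete_edges n. x e) = t" by simp
  have "scheme_op n \<alpha> \<beta> \<gamma> x e = y e" if e: "e \<in> complete_edges n" for e
  proof -
    have "(\<Sum>v\<in>e. star_sum n x v) = (\<Sum>v\<in>e. \<sigma> v)"
      using e by (intro sum.cong star_x) (auto simp: complete_edges_def)
    then show ?thesis
      unfolding scheme_op_def sum_x using assms(1) by (simp add: x_def field_simps)
  qed
  then show ?thesis by blast
qed

text \<open>The diagonal is zero because the bases polynomial is squarefree, so its second
  derivative in a single variable vanishes; \<open>pair_count\<close> would instead count the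
  forests through that edge.\<close>

definition pair_matrix :: "nat \<Rightarrow> nat \<Rightarrow> nat set \<Rightarrow> nat set \<Rightarrow> nat" where
  "pair_matrix n r f e = (if e = f then 0 else pair_count n r f e)"

text \<open>The inner sum is the size of the intersection of \<open>e\<close> and \<open>f\<close>:
  2, 1 or 0 for equal, adjacent or disjoint edges. The coefficients are fitted to the values 0,
  \<open>a\<close> and \<open>b\<close>.\<close>

lemma pair_matrix_eq:
  assumes "e \<in> complete_edges n" "f \<in> complete_edges n" "3 < n"
    and a: "a = pair_count n r {1, 2} {2, 3}" and b: "b = pair_count n r {1, 2} {3, 4}"
  shows "(of_nat (pair_matrix n r f e) :: 'k::comm_ring_1)
    = (of_nat b - 2 * of_nat a) * of_bool (e = f)
      + (of_nat a - of_nat b) * (\<Sum>v\<in>f. of_bool (v \<in> e)) + of_nat b"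
proof -
  obtain s t where f: "f = {s, t}" "s \<noteq> t" "s \<in> {1..n}" "t \<in> {1..n}"
    using assms(2) by (auto simp: complete_edges_def card_2_iff)
  obtain p q where e: "e = {p, q}" "p \<noteq> q" "p \<in> {1..n}" "q \<in> {1..n}"
    using assms(1) by (auto simp: complete_edges_def card_2_iff)
  have adjacent: "pair_count n r {x, y} {y, z} = a"
    if "distinct [x, y, z]" "{x, y, z} \<subseteq> {1..n}" for x y z
    using pair_count_adjacent[of x y z 1 2 3 n r] that assms(3) by (simp add: a)
  consider "e = f" | "e \<inter> f = {}" | "s \<in> e" "t \<notin> e" | "t \<in> e" "s \<notin> e"
    using e(1) f(1,2) by auto
  then show ?thesis
  proof cases
    case 1
    then show ?thesis using f by (simp add: pair_matrix_def)
  next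
    case 2
    then have "pair_count n r f e = b" unfolding b e(1) f(1)
      using e f assms(3) by (intro pair_count_disjoint) auto
    with 2 e(1) f show ?thesis by (auto simp: pair_matrix_def)
  next
    case 3
    then obtain w where w: "e = {s, w}" "w \<noteq> s" "w \<in> {1..n}" using e by (auto simp: insert_commute)
    then have "pair_count n r f e = a"
      using adjacent[of t s w] f 3 by (simp add: insert_commute)
    with 3 f show ?thesis by (auto simp: pair_matrix_def)
  next
    case 4
    then obtain w where w: "e = {t, w}" "w \<noteq> t" "w \<in> {1..n}" using e by (auto simp: insert_commute)
    then have "pair_count n r f e = a"
      using adjacent[of s t w] f 4 by simp
    with 4 f show ?thesis by (auto simp: pair_matrix_def)
  qed
qed

lemma sum_pair_matrix:
  fixes x :: "nat set \<Rightarrow> 'k::comm_ring_1"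
  assumes "f \<in> complete_edges n" "3 < n"
    and a: "a = pair_count n r {1, 2} {2, 3}" and b: "b = pair_count n r {1, 2} {3, 4}"
  shows "(\<Sum>e\<in>complete_edges n. of_nat (pair_matrix n r f e) * x e)
    = scheme_op n (of_nat b - 2 * of_nat a) (of_nat a - of_nat b) (of_nat b) x f"
proof -
  let ?E = "complete_edges n"
  have star: "star_sum n x v = (\<Sum>e\<in>?E. of_bool (v \<in> e) * x e)" for v
    unfolding star_sum_def sum.inter_filter[OF finite_complete_edges]
    by (rule sum.cong) auto
  have "(\<Sum>e\<in>?E. of_nat (pair_matrix n r f e) * x e)
      = (\<Sum>e\<in>?E. (of_nat b - 2 * of_nat a) * (of_bool (e = f) * x e)
        + (of_nat a - of_nat b) * (\<Sum>v\<in>f. of_bool (v \<in> e) * x e) + of_nat b * x e)"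
    by (rule sum.cong[OF refl])
      (simp only: pair_matrix_eq[OF _ assms] distrib_right mult.assoc sum_distrib_right)
  also have "\<dots> = (of_nat b - 2 * of_nat a) * (\<Sum>e\<in>?E. of_bool (e = f) * x e)
        + (of_nat a - of_nat b) * (\<Sum>v\<in>f. star_sum n x v) + of_nat b * (\<Sum>e\<in>?E. x e)"
    unfolding sum.distrib sum_distrib_left[symmetric] star by (subst sum.swap) simp
  also have "(\<Sum>e\<in>?E. of_bool (e = f) * x e) = x f"
    using assms(1) finite_complete_edges[of n]
    by (simp add: of_bool_def if_distrib[of "\<lambda>c. c * _"] cong: if_cong)
  finally show ?thesis by (simp add: scheme_op_def)
qed

text \<open>The three characters of the scheme at \<open>\<alpha> = b - 2a\<close>,
  \<open>\<beta> = a - b\<close>, \<open>\<gamma> = b\<close> are nonzero integers, and they stay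
  nonzero in a field of characteristic zero.\<close>

lemma pair_matrix_nondegenerate:
  fixes y :: "nat set \<Rightarrow> 'k::field_char_0"
  assumes "2 < r" "r < n"
  shows "(\<And>f. f \<in> complete_edges n \<Longrightarrow> (\<Sum>e\<in>complete_edges n. of_nat (pair_matrix n r f e) * x e) = (0 :: 'k))
      \<Longrightarrow> e \<in> complete_edges n \<Longrightarrow> x e = 0"
    and "\<exists>x. \<forall>f\<in>complete_edges n. (\<Sum>e\<in>complete_edges n. of_nat (pair_matrix n r f e) * x e) = y f"
proof -
  define a b where "a = pair_count n r {1, 2} {2, 3}" and "b = pair_count n r {1, 2} {3, 4}"
  have n: "3 < n" using assms by simp
  note op = sum_pair_matrix[OF _ n a_def b_def]
  have ab: "b < 2 * a" using disjoint_lt_twice_adjacent[OF assms] by (simp add: a_def b_def)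
  \<comment> \<open>The real inequality is restated over the integers, which embed into every field
    of characteristic zero.\<close>
  have int: "(int n - 4) * int a < (int n - 3) * int b"
  proof -
    have "real_of_int ((int n - 4) * int a) < real_of_int ((int n - 3) * int b)"
      using adjacent_lt_disjoint[OF assms] by (simp add: a_def b_def)
    then show ?thesis by (simp only: of_int_less_iff)
  qed
  have l2: "of_nat b - 2 * of_nat a \<noteq> (0 :: 'k)"
  proof
    assume "of_nat b - 2 * of_nat a = (0 :: 'k)"
    then have "of_nat b = (of_nat (2 * a) :: 'k)" by simp
    with ab show False by (simp only: of_nat_eq_iff)
  qed
  have l1: "of_nat b - 2 * of_nat a + (of_nat n - 2) * (of_nat a - of_nat b) \<noteq> (0 :: 'k)"
  proof -
    have "of_nat b - 2 * of_nat a + (of_nat n - 2) * (of_nat a - of_nat b)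
        = (of_int ((int n - 4) * int a - (int n - 3) * int b) :: 'k)" by (simp add: algebra_simps)
    then show ?thesis using int by (simp only: of_int_eq_0_iff)
  qed
  have l0: "2 * (of_nat b - 2 * of_nat a) + 4 * (of_nat n - 1) * (of_nat a - of_nat b)
      + of_nat n * (of_nat n - 1) * of_nat b \<noteq> (0 :: 'k)"
  proof -
    have "2 * (of_nat b - 2 * of_nat a) + 4 * (of_nat n - 1) * (of_nat a - of_nat b)
        + of_nat n * (of_nat n - 1) * of_nat b
        = (of_int (4 * (int n - 2) * int a + (int n - 2) * (int n - 3) * int b) :: 'k)"
      by (simp add: algebra_simps)
    \<comment> \<open>The inequality \<open>b < 2 * a\<close> forces \<open>a\<close> to be
      positive.\<close>
    moreover have "0 < 4 * (int n - 2) * int a + (int n - 2) * (int n - 3) * int b"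
      using n ab by (intro add_pos_nonneg mult_pos_pos mult_nonneg_nonneg) auto
    ultimately show ?thesis by (simp only: of_int_eq_0_iff)
  qed
  show "x e = 0"
    if "\<And>f. f \<in> complete_edges n \<Longrightarrow> (\<Sum>e\<in>complete_edges n. of_nat (pair_matrix n r f e) * x e) = (0 :: 'k)"
      "e \<in> complete_edges n"
    by (rule scheme_op_inj[OF l2 l1 l0 _ that(2)]) (simp add: that(1) flip: op)
  show "\<exists>x. \<forall>f\<in>complete_edges n. (\<Sum>e\<in>complete_edges n. of_nat (pair_matrix n r f e) * x e) = y f"
    using scheme_op_surj[OF l2 l1 l0, of y] by (simp add: op cong: ball_cong)
qed

section \<open>Homogeneous polynomials and their derivatives\<close>

lemma prod_var_eq_single:
  assumes "finite B"
  shows "(\<Prod>b\<in>B. var b :: ('x, 'k::comm_ring_1) mpoly)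
    = Poly_Mapping.single (\<Sum>b\<in>B. Poly_Mapping.single b 1) 1"
  using assms by (induction B) (simp_all add: var_def mult_single)

lemma lookup_sum_single:
  assumes "finite B"
  shows "Poly_Mapping.lookup (\<Sum>b\<in>B. Poly_Mapping.single b (1::nat)) i = of_bool (i \<in> B)"
  using assms by (simp add: lookup_sum lookup_single when_def of_bool_def)

lemma partial_deriv_single:
  "partial_deriv i (Poly_Mapping.single m c)
    = Poly_Mapping.single (m - Poly_Mapping.single i 1) (of_nat (Poly_Mapping.lookup m i) * c)"
  by (cases "c = 0") (simp_all add: partial_deriv_def)

lemma partial_deriv_prod_var:
  fixes B :: "'x set"
  assumes "finite B"
  shows "partial_deriv e (\<Prod>b\<in>B. var b :: ('x, 'k::comm_ring_1) mpoly)
    = (if e \<in> B then \<Prod>b\<in>B - {e}. var b else 0)"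
proof -
  have "(\<Sum>b\<in>B. Poly_Mapping.single b (1::nat)) - Poly_Mapping.single e 1
      = (\<Sum>b\<in>B - {e}. Poly_Mapping.single b 1)" if "e \<in> B"
    using assms that by (simp add: sum.remove[of B e])
  then show ?thesis
    using assms
    by (cases "e \<in> B") (simp_all add: prod_var_eq_single partial_deriv_single lookup_sum_single del: One_nat_def)
qed

lemma partial_deriv_sum: "partial_deriv i (sum f S) = (\<Sum>x\<in>S. partial_deriv i (f x))"
  by (induction S rule: infinite_finite_induct) (simp_all add: partial_deriv_add)

lemma diff_op_arg_sum: "diff_op P (sum f S) = (\<Sum>x\<in>S. diff_op P (f x))"
  by (induction S rule: infinite_finite_induct) (simp_all add: diff_op_arg_linear)

lemma const_1 [simp]: "const 1 = 1"
  by (simp add: const_def)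

lemma monom_deriv_0 [simp]: "monom_deriv 0 p = p"
  by (simp add: monom_deriv_def)

lemma monom_deriv_single: "monom_deriv (Poly_Mapping.single i 1) p = partial_deriv i p"
proof -
  interpret comp_fun_commute "\<lambda>j. partial_deriv j ^^ Poly_Mapping.lookup (Poly_Mapping.single i 1) j"
    by (rule comp_fun_commute_partial_deriv)
  show ?thesis by (simp add: monom_deriv_def)
qed

lemma diff_op_var: "diff_op (var i) p = partial_deriv i p"
  by (simp only: var_def diff_op_single monom_deriv_single const_1 mult_1)

lemma diff_op_const: "diff_op (const c) p = const c * p"
  unfolding const_def[of c] diff_op_single by simp

lemma sum_const_poly: "(\<Sum>x\<in>S. const (f x)) = const (\<Sum>x\<in>S. f x)"
  by (induction S rule: infinite_finite_induct) (simp_all add: const_simps)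

text \<open>Each application of the sum of all partial derivatives strikes out one variable of the
  monomial in every possible way; the factorial counts the orders of striking out all
  \<open>k\<close> of them.\<close>

lemma diff_op_sum_var_power:
  fixes E B :: "'x set"
  assumes "finite E" "B \<subseteq> E" "card B = k"
  shows "diff_op ((\<Sum>e\<in>E. var e) ^ k) (\<Prod>b\<in>B. var b :: ('x, 'k::{comm_ring_1, semiring_char_0}) mpoly)
    = const (fact k)"
  using assms(2,3)
proof (induction k arbitrary: B)
  case 0
  then have "B = {}" using finite_subset[OF _ assms(1)] by auto
  then show ?case
    using diff_op_const[of 1 "1 :: ('x, 'k) mpoly"] by simp
next
  case (Suc k)
  have fin: "finite B" using Suc.prems(1) assms(1) finite_subset by blast
  let ?L = "\<Sum>e\<in>E. var e :: ('x, 'k) mpoly"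
  have "diff_op ?L (\<Prod>b\<in>B. var b) = (\<Sum>e\<in>E. if e \<in> B then \<Prod>b\<in>B - {e}. var b else 0)"
    by (simp add: diff_op_sum diff_op_var partial_deriv_prod_var fin)
  also have "\<dots> = (\<Sum>e\<in>B. \<Prod>b\<in>B - {e}. var b)"
    using assms(1) Suc.prems(1) by (simp add: sum.If_cases Int_absorb1)
  finally have "diff_op (?L ^ Suc k) (\<Prod>b\<in>B. var b) = (\<Sum>e\<in>B. diff_op (?L ^ k) (\<Prod>b\<in>B - {e}. var b))"
    by (simp only: power_Suc2 diff_op_mult diff_op_arg_sum)
  also have "\<dots> = (\<Sum>e\<in>B. const (fact k))"
    using Suc.prems fin by (intro sum.cong refl Suc.IH) auto
  also have "\<dots> = const (fact (Suc k))"
    unfolding sum_const_poly using Suc.prems by simp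
  finally show ?case .
qed

text \<open>For \<open>e \<noteq> f\<close>, a basis through both leaves a squarefree monomial of
  degree \<open>r - 2\<close>, which the power of \<open>L\<close> turns into
  \<open>(r - 2)!\<close>. All other bases, and all of them if \<open>e = f\<close>, are
  annihilated.\<close>

lemma hessian_bases_poly:
  fixes E :: "'x set"
  assumes "finite E" "\<And>B. B \<in> \<B> \<Longrightarrow> B \<subseteq> E \<and> card B = r"
  shows "diff_op (var f * ((\<Sum>e\<in>E. var e) ^ (r - 2) * var e)) (bases_poly \<B> :: ('x, 'k::{comm_ring_1, semiring_char_0}) mpoly)
    = const (fact (r - 2) * of_nat (if e = f then 0 else card {B \<in> \<B>. f \<in> B \<and> e \<in> B}))"
proof -
  let ?L = "\<Sum>e\<in>E. var e :: ('x, 'k) mpoly"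
  have "\<B> \<subseteq> Pow E" using assms(2) by auto
  then have finB: "finite \<B>" using assms(1) finite_subset by blast
  have fin: "finite B" if "B \<in> \<B>" for B using assms(2)[OF that] assms(1) finite_subset by blast
  have "partial_deriv f (partial_deriv e (bases_poly \<B> :: ('x, 'k) mpoly))
      = (\<Sum>B\<in>\<B>. if e \<noteq> f \<and> f \<in> B \<and> e \<in> B then \<Prod>b\<in>B - {e} - {f}. var b else 0)"
    unfolding bases_poly_def partial_deriv_sum
    by (intro sum.cong refl) (use fin in \<open>auto simp: partial_deriv_prod_var\<close>)
  then have "diff_op (?L ^ (r - 2) * (var f * var e)) (bases_poly \<B>)
      = (\<Sum>B\<in>\<B>. diff_op (?L ^ (r - 2)) (if e \<noteq> f \<and> f \<in> B \<and> e \<in> B then \<Prod>b\<in>B - {e} - {f}. var b else 0))"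
    by (simp only: diff_op_mult diff_op_var diff_op_arg_sum)
  also have "\<dots> = (\<Sum>B\<in>\<B>. const (fact (r - 2) * of_bool (e \<noteq> f \<and> f \<in> B \<and> e \<in> B)))"
  proof (intro sum.cong refl)
    fix B assume B: "B \<in> \<B>"
    show "diff_op (?L ^ (r - 2)) (if e \<noteq> f \<and> f \<in> B \<and> e \<in> B then \<Prod>b\<in>B - {e} - {f}. var b else 0)
        = const (fact (r - 2) * of_bool (e \<noteq> f \<and> f \<in> B \<and> e \<in> B))"
    proof (cases "e \<noteq> f \<and> f \<in> B \<and> e \<in> B")
      case True
      have "B - {e} - {f} = B - {e, f}" by auto
      with True have "card (B - {e} - {f}) = r - 2"
        using assms(2)[OF B] card_Diff_subset[of "{e, f}" B] by auto
      then show ?thesis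
        using True assms(2)[OF B] diff_op_sum_var_power[OF assms(1), of "B - {e} - {f}" "r - 2"] by auto
    qed (auto simp: diff_op_arg_linear const_simps)
  qed
  also have "\<dots> = const (fact (r - 2) * (\<Sum>B\<in>\<B>. of_bool (e \<noteq> f \<and> f \<in> B \<and> e \<in> B)))"
    unfolding sum_const_poly sum_distrib_left ..
  also have "(\<Sum>B\<in>\<B>. of_bool (e \<noteq> f \<and> f \<in> B \<and> e \<in> B))
      = (of_nat (if e = f then 0 else card {B \<in> \<B>. f \<in> B \<and> e \<in> B}) :: 'k)"
    using finB by (simp add: Int_def)
  finally show ?thesis by (simp only: mult.left_commute)
qed

section \<open>Degrees and homogeneous polynomials\<close>

lemma monom_degree_superset:
  assumes "finite S" "Poly_Mapping.keys m \<subseteq> S"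
  shows "monom_degree m = (\<Sum>i\<in>S. Poly_Mapping.lookup m i)"
  unfolding monom_degree_def using assms
  by (intro sum.mono_neutral_left) (auto simp: in_keys_iff)

lemma monom_degree_add: "monom_degree (a + b) = monom_degree a + monom_degree b"
proof -
  let ?S = "Poly_Mapping.keys a \<union> Poly_Mapping.keys b"
  show ?thesis using Poly_Mapping.keys_add[of a b]
    by (simp add: monom_degree_superset[of ?S] lookup_add sum.distrib)
qed

lemma monom_degree_single [simp]: "monom_degree (Poly_Mapping.single i c) = c"
  by (cases "c = 0") (simp_all add: monom_degree_def)

lemma monom_degree_0_iff: "monom_degree m = 0 \<longleftrightarrow> m = 0"
  by (auto simp: monom_degree_def in_keys_iff intro!: poly_mapping_eqI)

lemma keys_add_nat:
  fixes a b :: "'x monom"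
  shows "Poly_Mapping.keys (a + b) = Poly_Mapping.keys a \<union> Poly_Mapping.keys b"
  by (auto simp: in_keys_iff lookup_add)

lemma monom_degree_Suc_obtain:
  assumes "monom_degree m = Suc j"
  obtains i m' where "m = Poly_Mapping.single i 1 + m'" "monom_degree m' = j"
proof -
  have "m \<noteq> 0" using assms monom_degree_0_iff[of m] by auto
  then obtain i where i: "Poly_Mapping.lookup m i \<noteq> 0" by (metis lookup_zero poly_mapping_eqI)
  have m: "m = Poly_Mapping.single i 1 + (m - Poly_Mapping.single i 1)"
    by (rule poly_mapping_eqI) (use i in \<open>auto simp: lookup_add lookup_minus lookup_single when_def\<close>)
  then have "monom_degree m = 1 + monom_degree (m - Poly_Mapping.single i 1)"
    by (metis monom_degree_add monom_degree_single)
  with assms m that show ?thesis by simp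
qed

lemma homogeneous_polys_iff:
  "p \<in> homogeneous_polys E j \<longleftrightarrow>
    (\<forall>m. Poly_Mapping.lookup p m \<noteq> 0 \<longrightarrow> Poly_Mapping.keys m \<subseteq> E \<and> monom_degree m = j)"
  by (auto simp: homogeneous_polys_def poly_ring_carrier in_keys_iff)

lemma homogeneous_polys_carrier: "p \<in> homogeneous_polys E j \<Longrightarrow> p \<in> carrier (poly_ring E)"
  by (simp add: homogeneous_polys_def)

lemma homogeneous_polys_0 [simp]: "0 \<in> homogeneous_polys E j"
  by (simp add: homogeneous_polys_iff)

lemma homogeneous_polys_add:
  "p \<in> homogeneous_polys E j \<Longrightarrow> q \<in> homogeneous_polys E j \<Longrightarrow> p + q \<in> homogeneous_polys E j"
  unfolding homogeneous_polys_iff lookup_add by (metis add_0)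

lemma homogeneous_polys_sum:
  "(\<And>x. x \<in> S \<Longrightarrow> f x \<in> homogeneous_polys E j) \<Longrightarrow> sum f S \<in> homogeneous_polys E j"
  by (induction S rule: infinite_finite_induct) (auto intro: homogeneous_polys_add)

lemma homogeneous_polys_const_mult:
  "p \<in> homogeneous_polys E j \<Longrightarrow> const c * p \<in> homogeneous_polys E j"
  unfolding homogeneous_polys_iff lookup_const_mult by (metis mult_zero_right)

lemma homogeneous_polys_mult:
  assumes "p \<in> homogeneous_polys E i" "q \<in> homogeneous_polys E j"
  shows "p * q \<in> homogeneous_polys E (i + j)"
  unfolding homogeneous_polys_def
proof (intro CollectI conjI ballI)
  show "p * q \<in> carrier (poly_ring E)"
    using assms by (intro poly_ring_closed homogeneous_polys_carrier)
  fix m assume "m \<in> Poly_Mapping.keys (p * q)"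
  then obtain a b where "a \<in> Poly_Mapping.keys p" "b \<in> Poly_Mapping.keys q" "m = a + b"
    using keys_mult[of p q] by blast
  then show "monom_degree m = i + j"
    using assms by (simp add: homogeneous_polys_def monom_degree_add)
qed

lemma homogeneous_polys_1: "1 \<in> homogeneous_polys E 0"
  by (simp add: homogeneous_polys_def poly_ring_carrier monom_degree_def)

lemma homogeneous_polys_power:
  "p \<in> homogeneous_polys E 1 \<Longrightarrow> p ^ k \<in> homogeneous_polys E k"
proof (induction k)
  case (Suc k)
  then show ?case using homogeneous_polys_mult[of p E 1 "p ^ k" k] by simp
qed (simp add: homogeneous_polys_1)

lemma var_homogeneous: "i \<in> E \<Longrightarrow> var i \<in> homogeneous_polys E 1"
  by (auto simp: homogeneous_polys_def poly_ring_carrier var_def split: if_splits)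

lemma bases_poly_homogeneous:
  assumes "finite E" "\<And>B. B \<in> \<B> \<Longrightarrow> B \<subseteq> E \<and> card B = r"
  shows "bases_poly \<B> \<in> homogeneous_polys E r"
  unfolding bases_poly_def
proof (rule homogeneous_polys_sum)
  fix B assume B: "B \<in> \<B>"
  have "(\<Prod>b\<in>B. var b) \<in> homogeneous_polys E (card B)" if "finite B" "B \<subseteq> E" for B
    using that
  proof (induction B)
    case (insert b B)
    then show ?case
      using homogeneous_polys_mult[OF var_homogeneous[of b E], of "\<Prod>b\<in>B. var b" "card B"] by simp
  qed (simp add: homogeneous_polys_1)
  then show "(\<Prod>b\<in>B. var b) \<in> homogeneous_polys E r"
    using assms(2)[OF B] finite_subset[OF _ assms(1)] by metis
qed

lemma partial_deriv_homogeneous: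
  assumes "p \<in> homogeneous_polys E (Suc d)"
  shows "partial_deriv i p \<in> homogeneous_polys E d"
  unfolding homogeneous_polys_iff
proof (intro allI impI)
  fix m assume "Poly_Mapping.lookup (partial_deriv i p) m \<noteq> 0"
  then have "Poly_Mapping.lookup p (m + Poly_Mapping.single i 1) \<noteq> 0"
    by (auto simp: lookup_partial_deriv)
  with assms have "Poly_Mapping.keys (m + Poly_Mapping.single i 1) \<subseteq> E"
    "monom_degree (m + Poly_Mapping.single i 1) = Suc d"
    unfolding homogeneous_polys_iff by blast+
  then show "Poly_Mapping.keys m \<subseteq> E \<and> monom_degree m = d"
    by (simp add: keys_add_nat monom_degree_add)
qed

text \<open>Induction on the degree of \<open>m\<close> peels off one partial derivative at a time,
  each lowering the degree by one.\<close>

lemma monom_deriv_homogeneous: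
  assumes "monom_degree m = j" "p \<in> homogeneous_polys E (j + d)"
  shows "monom_deriv m p \<in> homogeneous_polys E d"
  using assms
proof (induction j arbitrary: m d)
  case 0
  then show ?case by (simp add: monom_degree_0_iff)
next
  case (Suc j)
  from Suc.prems(1) obtain i m' where m: "m = Poly_Mapping.single i 1 + m'" "monom_degree m' = j"
    by (rule monom_degree_Suc_obtain)
  have "monom_deriv m' p \<in> homogeneous_polys E (Suc d)"
    using Suc.prems(2) by (intro Suc.IH m(2)) simp
  then show ?case
    unfolding m(1) monom_deriv_plus monom_deriv_single by (rule partial_deriv_homogeneous)
qed

lemma diff_op_homogeneous:
  assumes "P \<in> homogeneous_polys E j" "p \<in> homogeneous_polys E (j + d)"
  shows "diff_op P p \<in> homogeneous_polys E d"
  unfolding diff_op_def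
proof (intro homogeneous_polys_sum homogeneous_polys_const_mult)
  fix m assume "m \<in> Poly_Mapping.keys P"
  with assms(1) have "monom_degree m = j" by (simp add: homogeneous_polys_def)
  then show "monom_deriv m p \<in> homogeneous_polys E d"
    using assms(2) by (rule monom_deriv_homogeneous)
qed

section \<open>Linear forms and their coefficients\<close>

lemma linear_form_eqI:
  assumes "p \<in> homogeneous_polys E 1" "q \<in> homogeneous_polys E 1"
    and "\<And>f. f \<in> E \<Longrightarrow>
      Poly_Mapping.lookup p (Poly_Mapping.single f 1) = Poly_Mapping.lookup q (Poly_Mapping.single f 1)"
  shows "p = q"
proof (rule poly_mapping_eqI)
  fix m
  show "Poly_Mapping.lookup p m = Poly_Mapping.lookup q m"
  proof (rule ccontr)
    assume ne: "Poly_Mapping.lookup p m \<noteq> Poly_Mapping.lookup q m"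
    then have "Poly_Mapping.lookup p m \<noteq> 0 \<or> Poly_Mapping.lookup q m \<noteq> 0" by auto
    then have m: "Poly_Mapping.keys m \<subseteq> E" "monom_degree m = Suc 0"
      using assms(1,2) unfolding homogeneous_polys_iff One_nat_def by blast+
    from m(2) obtain i m' where "m = Poly_Mapping.single i 1 + m'" "monom_degree m' = 0"
      by (rule monom_degree_Suc_obtain)
    then have "m = Poly_Mapping.single i 1" by (simp add: monom_degree_0_iff)
    with m(1) assms(3)[of i] ne show False by simp
  qed
qed

lemma lookup_linear_form:
  assumes "finite E" "f \<in> E"
  shows "Poly_Mapping.lookup (\<Sum>e\<in>E. const (x e) * var e) (Poly_Mapping.single f 1) = x f"
proof -
  have "Poly_Mapping.lookup (const (x e) * var e) (Poly_Mapping.single f 1) = (if e = f then x e else 0)"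
    for e
  proof -
    have "Poly_Mapping.single e (1::nat) = Poly_Mapping.single f 1 \<longleftrightarrow> e = f"
      by (metis keys_single singleton_inject zero_neq_one)
    then show ?thesis by (simp add: lookup_const_mult var_def lookup_single when_def del: One_nat_def)
  qed
  then show ?thesis using assms by (simp add: lookup_sum)
qed

lemma linear_form_homogeneous: "(\<Sum>e\<in>E. const (x e) * var e) \<in> homogeneous_polys E 1"
  by (intro homogeneous_polys_sum homogeneous_polys_const_mult var_homogeneous)

lemma linear_form_eq:
  assumes "finite E" "p \<in> homogeneous_polys E 1"
  shows "p = (\<Sum>e\<in>E. const (Poly_Mapping.lookup p (Poly_Mapping.single e 1)) * var e)"
  by (rule linear_form_eqI[OF assms(2) linear_form_homogeneous])
    (simp only: lookup_linear_form[OF assms(1)])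

text \<open>Reading a coefficient becomes one more derivative, which can be absorbed into the
  differential operator by \<open>diff_op_mult\<close>.\<close>

lemma lookup_single_eq_diff_op:
  "Poly_Mapping.lookup p (Poly_Mapping.single f 1) = Poly_Mapping.lookup (diff_op (var f) p) 0"
  by (simp add: diff_op_var lookup_partial_deriv)

lemma lookup_const_0 [simp]: "Poly_Mapping.lookup (const c) 0 = c"
  by (simp add: const_def)

lemma lookup_diff_op_power_linear:
  fixes p :: "('x, 'k::{comm_ring_1, semiring_char_0}) mpoly"
  assumes "finite E" "\<And>B. B \<in> \<B> \<Longrightarrow> B \<subseteq> E \<and> card B = r" "p \<in> homogeneous_polys E 1"
  shows "Poly_Mapping.lookup (diff_op ((\<Sum>e\<in>E. var e) ^ (r - 2) * p) (bases_poly \<B>)) (Poly_Mapping.single f 1)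
    = fact (r - 2) * (\<Sum>e\<in>E. of_nat (if e = f then 0 else card {B \<in> \<B>. f \<in> B \<and> e \<in> B})
        * Poly_Mapping.lookup p (Poly_Mapping.single e 1))"
proof -
  let ?L = "\<Sum>e\<in>E. var e :: ('x, 'k) mpoly"
  let ?x = "\<lambda>e. Poly_Mapping.lookup p (Poly_Mapping.single e 1)"
  let ?h = "\<lambda>e. of_nat (if e = f then 0 else card {B \<in> \<B>. f \<in> B \<and> e \<in> B}) :: 'k"
  have "var f * (?L ^ (r - 2) * p) = var f * (?L ^ (r - 2) * (\<Sum>e\<in>E. const (?x e) * var e))"
    using linear_form_eq[OF assms(1,3)] by simp
  also have "\<dots> = (\<Sum>e\<in>E. const (?x e) * (var f * (?L ^ (r - 2) * var e)))"
    by (simp only: sum_distrib_left mult.left_commute[of _ "const _"])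
  finally have "diff_op (var f * (?L ^ (r - 2) * p)) (bases_poly \<B>)
      = (\<Sum>e\<in>E. const (?x e) * const (fact (r - 2) * ?h e))"
    by (simp only: diff_op_sum diff_op_mult[of "const _"] diff_op_const
        hessian_bases_poly[OF assms(1,2)])
  then have "diff_op (var f * (?L ^ (r - 2) * p)) (bases_poly \<B>)
      = const (\<Sum>e\<in>E. ?x e * (fact (r - 2) * ?h e))"
    by (simp only: sum_const_poly const_simps(3)[symmetric])
  then show ?thesis
    by (simp only: lookup_single_eq_diff_op diff_op_mult[symmetric] lookup_const_0)
      (simp add: sum_distrib_left mult_ac)
qed

text \<open>Two classes agree exactly when the difference of the representatives annihilates
  \<open>\<Phi>\<close>. Equality in the quotient thus becomes equality of polynomials, which can be
  tested coefficientwise.\<close>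

lemma ann_class_eq_iff:
  assumes "p \<in> carrier (poly_ring E)" "q \<in> carrier (poly_ring E)"
  shows "ann_class E \<Phi> p = ann_class E \<Phi> q \<longleftrightarrow> diff_op p \<Phi> = diff_op q \<Phi>"
proof -
  interpret ideal "Ann E \<Phi>" "poly_ring E" by (rule Ann_ideal)
  have "ann_class E \<Phi> p = ann_class E \<Phi> q \<longleftrightarrow> p \<ominus>\<^bsub>poly_ring E\<^esub> q \<in> Ann E \<Phi>"
    unfolding ann_class_def using quotient_eq_iff_same_a_r_cos[OF Ann_ideal assms] by auto
  also have "p \<ominus>\<^bsub>poly_ring E\<^esub> q = p - q"
    using assms by (simp add: a_minus_def poly_ring_a_inv)
  also have "p - q \<in> Ann E \<Phi> \<longleftrightarrow> diff_op (p - q) \<Phi> = 0"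
    using poly_ring_closed(1)[OF assms(1) poly_ring_closed(3)[OF assms(2,2)]]
    unfolding Ann_def diff_conv_add_uminus by blast
  also have "diff_op (p - q) \<Phi> = diff_op p \<Phi> - diff_op q \<Phi>"
    using diff_op_add[of "p - q" q \<Phi>] by simp
  finally show ?thesis by simp
qed

text \<open>The class map is a ring homomorphism, so products in the quotient are computed on
  representatives.\<close>

lemma ann_class_power_mult:
  assumes "l \<in> carrier (poly_ring E)" "p \<in> carrier (poly_ring E)"
  shows "ann_class E \<Phi> l [^]\<^bsub>ann_quot E \<Phi>\<^esub> (k::nat) \<otimes>\<^bsub>ann_quot E \<Phi>\<^esub> ann_class E \<Phi> p
    = ann_class E \<Phi> (l ^ k * p)"
proof -
  interpret ideal "Ann E \<Phi>" "poly_ring E" by (rule Ann_ideal)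
  have hom: "ann_class E \<Phi> \<in> ring_hom (poly_ring E) (ann_quot E \<Phi>)"
    using rcos_ring_hom unfolding ann_class_def[abs_def] ann_quot_def .
  have mult: "ann_class E \<Phi> (a * b) = ann_class E \<Phi> a \<otimes>\<^bsub>ann_quot E \<Phi>\<^esub> ann_class E \<Phi> b"
    if "a \<in> carrier (poly_ring E)" "b \<in> carrier (poly_ring E)" for a b
    using ring_hom_mult[OF hom that] by simp
  have one: "1 \<in> carrier (poly_ring E)" by (simp add: poly_ring_carrier)
  have closed: "l ^ k \<in> carrier (poly_ring E)" for k
    by (induction k) (simp_all add: one assms poly_ring_closed)
  have "ann_class E \<Phi> l [^]\<^bsub>ann_quot E \<Phi>\<^esub> k = ann_class E \<Phi> (l ^ k)"
  proof (induction k)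
    case 0
    then show ?case using ring_hom_one[OF hom] by (simp add: nat_pow_def)
  next
    case (Suc k)
    then show ?case using mult[OF closed[of k] assms(1)] by (simp add: nat_pow_def mult.commute)
  qed
  then show ?thesis using mult[OF closed[of k] assms(2)] by simp
qed

theorem theorem3p7:
  fixes n r :: nat
    and E :: "nat set set"
    and \<Phi> L :: "(nat set, 'k::field_char_0) mpoly"
  assumes "0 < n" and "2 < r" and "r < n"
    and "E = complete_edges n"
    and "\<Phi> = bases_poly (truncated_graphic_bases n r)"
    and "L = (\<Sum>e \<in> E. var e)"
  shows "bij_betw
    (\<lambda>a. ann_class E \<Phi> L [^]\<^bsub>ann_quot E \<Phi>\<^esub> (r - 2) \<otimes>\<^bsub>ann_quot E \<Phi>\<^esub> a)
    (ann_quot_component E \<Phi> 1) (ann_quot_component E \<Phi> (r - 1))"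
proof -
  let ?\<B> = "truncated_graphic_bases n r"
  let ?m = "\<lambda>a. ann_class E \<Phi> L [^]\<^bsub>ann_quot E \<Phi>\<^esub> (r - 2) \<otimes>\<^bsub>ann_quot E \<Phi>\<^esub> a"
  let ?coeff = "\<lambda>p e. Poly_Mapping.lookup p (Poly_Mapping.single e 1) :: 'k"
  have fin: "finite E" by (simp add: assms(4) finite_complete_edges)
  have bases: "B \<subseteq> E \<and> card B = r" if "B \<in> ?\<B>" for B
    using that by (simp add: truncated_graphic_bases_def assms(4))
  have L: "L \<in> homogeneous_polys E 1"
    unfolding assms(6) by (intro homogeneous_polys_sum var_homogeneous)
  have Lp: "L ^ (r - 2) * p \<in> homogeneous_polys E (r - 1)" if "p \<in> homogeneous_polys E 1" for p
    using homogeneous_polys_mult[OF homogeneous_polys_power[OF L] that, of "r - 2"] assms(2)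
    by (simp add: numeral_2_eq_2 Suc_diff_Suc)
  have mult: "?m (ann_class E \<Phi> p) = ann_class E \<Phi> (L ^ (r - 2) * p)"
    if "p \<in> homogeneous_polys E 1" for p
    using that L by (intro ann_class_power_mult homogeneous_polys_carrier)
  \<comment> \<open>Here \<open>\<Phi>\<close> has degree \<open>r\<close>, so an operator of degree
    \<open>r - 1\<close> leaves a linear form, which is determined by its coefficients at the
    edges.\<close>
  have linear: "diff_op q \<Phi> \<in> homogeneous_polys E 1" if "q \<in> homogeneous_polys E (r - 1)" for q
    by (rule diff_op_homogeneous[OF that])
      (use bases_poly_homogeneous[OF fin bases] assms(2) in \<open>simp add: assms(5)\<close>)
  have coeff: "?coeff (diff_op (L ^ (r - 2) * p) \<Phi>) f
      = fact (r - 2) * (\<Sum>e\<in>E. of_nat (pair_matrix n r f e) * ?coeff p e)"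
    if "p \<in> homogeneous_polys E 1" for p f
    using lookup_diff_op_power_linear[where \<B> = ?\<B> and f = f, OF fin bases that]
    by (simp only: assms(5,6) pair_matrix_def pair_count_def)
  \<comment> \<open>This yields equality of the representatives themselves, hence in particular of
    their classes in \<open>A_1\<close>.\<close>
  have inj: "p = q"
    if p: "p \<in> homogeneous_polys E 1" and q: "q \<in> homogeneous_polys E 1"
      and eq: "?m (ann_class E \<Phi> p) = ?m (ann_class E \<Phi> q)" for p q
  proof (rule linear_form_eqI[OF p q])
    have "diff_op (L ^ (r - 2) * p) \<Phi> = diff_op (L ^ (r - 2) * q) \<Phi>"
      using eq unfolding mult[OF p] mult[OF q]
        ann_class_eq_iff[OF Lp[OF p, THEN homogeneous_polys_carrier] Lp[OF q, THEN homogeneous_polys_carrier]] .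
    then have "fact (r - 2) * (\<Sum>e\<in>E. of_nat (pair_matrix n r f e) * ?coeff p e)
        = fact (r - 2) * (\<Sum>e\<in>E. of_nat (pair_matrix n r f e) * ?coeff q e)" for f
      by (simp only: coeff[OF p, symmetric] coeff[OF q, symmetric])
    then have "(\<Sum>e\<in>E. of_nat (pair_matrix n r f e) * (?coeff p e - ?coeff q e)) = 0" for f
      by (simp add: right_diff_distrib sum_subtractf)
    from pair_matrix_nondegenerate(1)[OF assms(2,3), of "\<lambda>e. ?coeff p e - ?coeff q e"] this
    show "?coeff p f = ?coeff q f" if "f \<in> E" for f
      using that by (simp add: assms(4))
  qed
  have surj: "\<exists>p\<in>homogeneous_polys E 1. ?m (ann_class E \<Phi> p) = ann_class E \<Phi> q"
    if q: "q \<in> homogeneous_polys E (r - 1)" for q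
  proof -
    \<comment> \<open>The class of \<open>q\<close> is determined by the linear form
      \<open>diff_op q \<Phi>\<close>, so its coefficients are the targets of the linear system.
      Division by \<open>(r - 2)!\<close> is possible in characteristic zero.\<close>
    obtain x :: "nat set \<Rightarrow> 'k" where x: "\<And>f. f \<in> E \<Longrightarrow>
        (\<Sum>e\<in>E. of_nat (pair_matrix n r f e) * x e) = ?coeff (diff_op q \<Phi>) f / fact (r - 2)"
      using pair_matrix_nondegenerate(2)[OF assms(2,3), of "\<lambda>f. ?coeff (diff_op q \<Phi>) f / fact (r - 2)"]
      unfolding assms(4) by blast
    define p where "p = (\<Sum>e\<in>E. const (x e) * var e)"
    have p: "p \<in> homogeneous_polys E 1" unfolding p_def by (rule linear_form_homogeneous)
    have "diff_op (L ^ (r - 2) * p) \<Phi> = diff_op q \<Phi>"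
    proof (rule linear_form_eqI[OF linear[OF Lp[OF p]] linear[OF q]])
      fix f assume f: "f \<in> E"
      have "(\<Sum>e\<in>E. of_nat (pair_matrix n r f e) * ?coeff p e)
          = (\<Sum>e\<in>E. of_nat (pair_matrix n r f e) * x e)"
        unfolding p_def by (rule sum.cong) (simp_all only: lookup_linear_form[OF fin])
      then show "?coeff (diff_op (L ^ (r - 2) * p) \<Phi>) f = ?coeff (diff_op q \<Phi>) f"
        unfolding coeff[OF p] by (simp add: x[OF f])
    qed
    then have "?m (ann_class E \<Phi> p) = ann_class E \<Phi> q"
      unfolding mult[OF p]
        ann_class_eq_iff[OF Lp[OF p, THEN homogeneous_polys_carrier] q[THEN homogeneous_polys_carrier]] .
    with p show ?thesis by blast
  qed
  show ?thesis unfolding bij_betw_def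
  proof
    show "inj_on ?m (ann_quot_component E \<Phi> 1)"
      unfolding ann_quot_component_def by (rule inj_onI) (elim imageE, metis inj)
    show "?m ` ann_quot_component E \<Phi> 1 = ann_quot_component E \<Phi> (r - 1)"
    proof
      show "?m ` ann_quot_component E \<Phi> 1 \<subseteq> ann_quot_component E \<Phi> (r - 1)"
        unfolding ann_quot_component_def by (intro subsetI, elim imageE) (metis mult Lp imageI)
      show "ann_quot_component E \<Phi> (r - 1) \<subseteq> ?m ` ann_quot_component E \<Phi> 1"
        unfolding ann_quot_component_def by (intro subsetI, elim imageE) (metis surj imageI)
    qed
  qed
qed

end
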